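(* The binary Golay code $G_{23}$ and the extended binary Golay code $G_{24}$ are $\mathbb{Z}_2\mathbb{Z}_2[u]$-linear codes. Moreover, the parameters $(\alpha,\beta)$ with $\beta>0$ for which they are $\mathbb{Z}_2\mathbb{Z}_2[u]$-linear are exactly: (i) $(0,12)$ and $(8,8)$ for $G_{24}$; (ii) $(7,8)$ for $G_{23}$.
   Context: $G_{23}$ is the binary $[23,12,7]$ perfect Golay code and $G_{24}$ its extension by an overall parity bit, a $[24,12,8]$ code. Let $\mathbb{Z}_2[u]=\{0,1,u,1+u\}$ be the ring with $u^2=0$, $\pi:\mathbb{Z}_2[u]\to\mathbb{Z}_2$ with $\pi(0)=\pi(u)=0$, $\pi(1)=\pi(1+u)=1$. $\mathbb{Z}_2^\alpha\times\mathbb{Z}_2[u]^\beta$ is a $\mathbb{Z}_2[u]$-module with componentwise addition and scalar multiplication $\lambda(x_1,\dots,x_\alpha\mid x'_1,\dots,x'_\beta)=(\pi(\lambda)x_1,\dots,\pi(\lambda)x_\alpha\mid\lambda x'_1,\dots,\lambda x'_\beta)$; a $\mathbb{Z}_2\mathbb{Z}_2[u]$-additive code with parameters $(\alpha,\beta)$ is a $\mathbb{Z}_2[u]$-submodule of it. $\psi:\mathbb{Z}_2[u]\to\mathbb{Z}_2^2$ is $\psi(0)=(0,0)$, $\psi(1)=(0,1)$, $\psi(u)=(1,1)$, $\psi(1+u)=(1,0)$, extended coordinatewise, and $\Psi(x\mid x')=(x\mid\psi(x'))$. A binary code $C$ of length $\alpha+2\beta$ is $\mathbb{Z}_2\mathbb{Z}_2[u]$-linear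 with parameters $(\alpha,\beta)$ if, after a suitable permutation of coordinates, $C=\Psi(\mathcal{C})$ for a $\mathbb{Z}_2\mathbb{Z}_2[u]$-additive code $\mathcal{C}$ with parameters $(\alpha,\beta)$. *)

theory Defs
  imports
    "HOL-Library.Z2"
    "HOL-Library.Function_Algebras"
    "HOL-Library.Product_Plus"
    "HOL-Combinatorics.Permutations"
    "HOL-Computational_Algebra.Polynomial"
begin

section \<open>The ring of dual numbers over the two-element field\<close>

text \<open>\<open>Dual a b\<close> stands for \<open>a + b u\<close>, where \<open>u * u = 0\<close>.\<close>

datatype z2u = Dual (re_part: bit) (u_part: bit)

instantiation z2u :: comm_ring_1
begin

definition "0 = Dual 0 0"
definition "1 = Dual 1 0"
definition "x + y = Dual (re_part x + re_part y) (u_part x + u_part y)"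
definition "- x = Dual (- re_part x) (- u_part x)"
definition "x - y = Dual (re_part x - re_part y) (u_part x - u_part y)" for x y :: z2u
definition "x * y = Dual (re_part x * re_part y) (re_part x * u_part y + u_part x * re_part y)"

instance
proof
  fix a b c :: z2u
  note defs = zero_z2u_def one_z2u_def plus_z2u_def uminus_z2u_def minus_z2u_def times_z2u_def
  show "a * b * c = a * (b * c)" "a * b = b * a" "1 * a = a"
    "a + b + c = a + (b + c)" "a + b = b + a" "0 + a = a" "- a + a = 0" "a - b = a + - b"
    "(a + b) * c = a * c + b * c" "(0 :: z2u) \<noteq> 1"
    by (simp_all only: defs z2u.sel z2u.inject z2u.collapse distrib_left distrib_right ac_simps
        add_0_left mult_1_left mult_zero_left mult_zero_right add_0_right right_minus left_minus
        diff_conv_add_uminus minus_add_distrib zero_neq_one simp_thms)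
qed

end

definition u_elt :: z2u where
  "u_elt = Dual 0 1"

definition pi_map :: "z2u \<Rightarrow> bit" where
  "pi_map x = re_part x"

definition psi :: "z2u \<Rightarrow> bit \<times> bit" where
  "psi x = (if x = 0 then (0, 0) else if x = 1 then (0, 1) else if x = u_elt then (1, 1) else (1, 0))"

lemmas z2u_defs = zero_z2u_def one_z2u_def plus_z2u_def uminus_z2u_def minus_z2u_def
  times_z2u_def u_elt_def

lemma UNIV_z2u: "(UNIV :: z2u set) = {0, 1, u_elt, 1 + u_elt}"
proof -
  have "x \<in> {0, 1, u_elt, 1 + u_elt}" for x :: z2u
    by (cases x; cases "re_part x"; cases "u_part x") (auto simp: z2u_defs)
  then show ?thesis by auto
qed

lemma u_elt_times_u_elt: "u_elt * u_elt = 0"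
  by (simp add: z2u_defs)

lemma pi_map_simps: "pi_map 0 = 0" "pi_map u_elt = 0" "pi_map 1 = 1" "pi_map (1 + u_elt) = 1"
  by (simp_all add: pi_map_def z2u_defs)

lemma psi_simps: "psi 0 = (0, 0)" "psi 1 = (0, 1)" "psi u_elt = (1, 1)" "psi (1 + u_elt) = (1, 0)"
  by (simp_all add: psi_def z2u_defs)


section \<open>Additive codes and their binary images\<close>

text \<open>
  A word of length \<open>n\<close> over \<open>'a\<close> is a function on \<open>nat\<close> that vanishes outside \<open>{..<n}\<close>.  A set of
  such functions does not determine its length, so the length is always passed explicitly.
\<close>

definition words :: "nat \<Rightarrow> (nat \<Rightarrow> 'a :: zero) set" where
  "words n = {x. \<forall>i\<ge>n. x i = 0}"

definition mixed_words :: "nat \<Rightarrow> nat \<Rightarrow> ((nat \<Rightarrow> bit) \<times> (nat \<Rightarrow> z2u)) set" where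
  "mixed_words \<alpha> \<beta> = words \<alpha> \<times> words \<beta>"

definition mixed_scale ::
  "z2u \<Rightarrow> (nat \<Rightarrow> bit) \<times> (nat \<Rightarrow> z2u) \<Rightarrow> (nat \<Rightarrow> bit) \<times> (nat \<Rightarrow> z2u)" where
  "mixed_scale c v = (\<lambda>i. pi_map c * fst v i, \<lambda>i. c * snd v i)"

interpretation mixed: module mixed_scale
proof
  fix a b :: z2u and x y :: "(nat \<Rightarrow> bit) \<times> (nat \<Rightarrow> z2u)"
  have pi: "pi_map (a + b) = pi_map a + pi_map b" "pi_map (a * b) = pi_map a * pi_map b"
    by (simp_all add: pi_map_def plus_z2u_def times_z2u_def)
  show "mixed_scale a (x + y) = mixed_scale a x + mixed_scale a y"
    "mixed_scale (a + b) x = mixed_scale a x + mixed_scale b x"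
    "mixed_scale a (mixed_scale b x) = mixed_scale (a * b) x" "mixed_scale 1 x = x"
    by (simp_all only: mixed_scale_def pi pi_map_simps prod_eq_iff fun_eq_iff fst_conv snd_conv
        fst_add snd_add plus_fun_apply distrib_left distrib_right mult.assoc mult_1_left simp_thms)
qed

lemma mixed_words_subspace: "mixed.subspace (mixed_words \<alpha> \<beta>)"
  by (auto simp: mixed.subspace_def mixed_words_def words_def mixed_scale_def zero_prod_def)

definition additive_code :: "nat \<Rightarrow> nat \<Rightarrow> ((nat \<Rightarrow> bit) \<times> (nat \<Rightarrow> z2u)) set \<Rightarrow> bool" where
  "additive_code \<alpha> \<beta> D \<longleftrightarrow> D \<subseteq> mixed_words \<alpha> \<beta> \<and> mixed.subspace D"

text \<open>
  \<open>Psi \<alpha> \<beta> (x, y)\<close> is \<open>x\<close> on the first \<open>\<alpha>\<close> positions, followed by the \<open>\<beta>\<close> pairs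
  \<open>psi (y 0), \<dots>, psi (y (\<beta> - 1))\<close>.
\<close>

definition Psi :: "nat \<Rightarrow> nat \<Rightarrow> (nat \<Rightarrow> bit) \<times> (nat \<Rightarrow> z2u) \<Rightarrow> nat \<Rightarrow> bit" where
  "Psi \<alpha> \<beta> v = (\<lambda>i.
     if i < \<alpha> then fst v i
     else if i < \<alpha> + 2 * \<beta> then
       (let p = psi (snd v ((i - \<alpha>) div 2)) in if even (i - \<alpha>) then fst p else snd p)
     else 0)"

definition z2z2u_linear :: "nat \<Rightarrow> (nat \<Rightarrow> bit) set \<Rightarrow> nat \<Rightarrow> nat \<Rightarrow> bool" where
  "z2z2u_linear n C \<alpha> \<beta> \<longleftrightarrow>
     n = \<alpha> + 2 * \<beta> \<and> C \<subseteq> words n \<and>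
     (\<exists>\<sigma> D. \<sigma> permutes {..<n} \<and> additive_code \<alpha> \<beta> D \<and> (\<lambda>c. c \<circ> \<sigma>) ` C = Psi \<alpha> \<beta> ` D)"


section \<open>The binary Golay codes\<close>

text \<open>
  The \<open>[23, 12, 7]\<close> code is unique up to a permutation of coordinates; the representative used
  here is the cyclic one, a word \<open>c\<close> being identified with the polynomial
  \<open>c 0 + c 1 x + \<dots> + c 22 x\<^sup>2\<^sup>2\<close>.
\<close>

definition golay_poly :: "bit poly" where
  "golay_poly = [:1, 0, 1, 0, 1, 1, 1, 0, 0, 0, 1, 1:]"

definition golay23 :: "(nat \<Rightarrow> bit) set" where
  "golay23 = coeff ` {p. degree p < 23 \<and> golay_poly dvd p}"

definition golay24 :: "(nat \<Rightarrow> bit) set" where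
  "golay24 = (\<lambda>c. c(23 := (\<Sum>i<23. c i))) ` golay23"


subsection \<open>The parameters [23, 12, 7]\<close>

definition weight :: "(nat \<Rightarrow> bit) \<Rightarrow> nat" where
  "weight c = card {i. c i \<noteq> 0}"

lemma golay_poly_nonzero: "golay_poly \<noteq> 0"
  by (simp add: golay_poly_def)

lemma golay23_alt: "golay23 = (\<lambda>q. coeff (golay_poly * q)) ` {q. degree q < 12}"
proof -
  have "golay_poly \<noteq> 0" "degree golay_poly = 11"
    by (simp_all add: golay_poly_def)
  then have deg: "degree (golay_poly * q) < 23 \<longleftrightarrow> degree q < 12" for q
    by (cases "q = 0") (simp_all add: degree_mult_eq)
  have "{p. degree p < 23 \<and> golay_poly dvd p} = (*) golay_poly ` {q. degree q < 12}"
  proof (intro set_eqI iffI)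
    fix p assume "p \<in> {p. degree p < 23 \<and> golay_poly dvd p}"
    then obtain q where "p = golay_poly * q" "degree p < 23" by (auto simp: dvd_def)
    then show "p \<in> (*) golay_poly ` {q. degree q < 12}" using deg by blast
  next
    fix p assume "p \<in> (*) golay_poly ` {q. degree q < 12}"
    then obtain q where "p = golay_poly * q" "degree q < 12" by blast
    then show "p \<in> {p. degree p < 23 \<and> golay_poly dvd p}" using deg by simp
  qed
  then show ?thesis
    by (simp only: golay23_def image_image)
qed

lemma golay23_subset_words: "golay23 \<subseteq> words 23"
  by (auto simp: golay23_def words_def intro!: coeff_eq_0)

lemma golay23_zero: "0 \<in> golay23"
  unfolding golay23_def by (rule image_eqI[of _ _ 0]) (auto simp: fun_eq_iff)

lemma golay23_add:
  assumes "c \<in> golay23" "d \<in> golay23"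
  shows "c + d \<in> golay23"
proof -
  from assms obtain p q where p: "degree p < 23" "golay_poly dvd p" "c = coeff p"
    and q: "degree q < 23" "golay_poly dvd q" "d = coeff q"
    unfolding golay23_def by blast
  have "degree (p + q) < 23" "golay_poly dvd p + q"
    using p q by (simp_all only: degree_add_less dvd_add)
  moreover have "c + d = coeff (p + q)"
    unfolding p q by (rule ext) (simp only: plus_fun_apply coeff_add)
  ultimately show ?thesis
    unfolding golay23_def by blast
qed

lemma card_degree_less:
  "finite {q :: bit poly. degree q < Suc n} \<and> card {q :: bit poly. degree q < Suc n} = 2 ^ Suc n"
proof (induction n)
  case 0
  have "q \<in> {0, 1}" if "degree q = 0" for q :: "bit poly"
  proof -
    obtain a where "q = [:a:]" using \<open>degree q = 0\<close> by (rule degree_eq_zeroE)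
    then show ?thesis by (cases a) auto
  qed
  then have "{q :: bit poly. degree q < Suc 0} = {0, 1}" by auto
  then show ?case by simp
next
  case (Suc n)
  let ?A = "{q :: bit poly. degree q < Suc n}"
  have "q \<in> pCons 0 ` ?A \<union> pCons 1 ` ?A" if "degree q < Suc (Suc n)" for q :: "bit poly"
  proof (cases q)
    case (pCons a p)
    with that have "degree p < Suc n"
      by (cases "p = 0") simp_all
    with pCons show ?thesis by (cases "a = 0") simp_all
  qed
  moreover have "degree (pCons a p) < Suc (Suc n)" if "degree p < Suc n" for a and p :: "bit poly"
    using that by (metis Suc_mono degree_pCons_le le_less_trans)
  ultimately have eq: "{q :: bit poly. degree q < Suc (Suc n)} = pCons 0 ` ?A \<union> pCons 1 ` ?A"
    by blast
  have card: "card (pCons a ` ?A) = card ?A" for a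
    by (rule card_image) (simp add: inj_on_def)
  have "pCons 0 ` ?A \<inter> pCons 1 ` ?A = {}" by auto
  with Suc have "card (pCons 0 ` ?A \<union> pCons 1 ` ?A) = card ?A + card ?A"
    by (simp only: card_Un_disjoint finite_imageI card)
  with Suc show ?case unfolding eq by simp
qed

lemma card_golay23: "card golay23 = 2 ^ 12"
proof -
  have "inj_on (\<lambda>q. coeff (golay_poly * q)) {q. degree q < 12}"
    using golay_poly_nonzero by (auto simp: inj_on_def coeff_inject)
  then show ?thesis
    unfolding golay23_alt using card_degree_less[of 11] by (simp add: card_image)
qed

context
begin

private fun padd :: "bool list \<Rightarrow> bool list \<Rightarrow> bool list" where
  "padd [] ys = ys"
| "padd (x # xs) [] = x # xs"
| "padd (x # xs) (y # ys) = (if x then \<not> y else y) # padd xs ys"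

private fun count :: "bool list \<Rightarrow> nat" where
  "count [] = 0"
| "count (x # xs) = (if x then Suc (count xs) else count xs)"

private definition to_poly :: "bool list \<Rightarrow> bit poly" where
  "to_poly xs = Poly (map of_bool xs)"

private definition gl :: "bool list" where
  "gl = [True, False, True, False, True, True, True, False, False, False, True, True]"

private fun pop :: "nat \<Rightarrow> bool list \<Rightarrow> nat \<times> bool list" where
  "pop k [] = (k, [])"
| "pop k (x # xs) = (if x then k - 1 else k, xs)"

text \<open>
  \<open>chk n nz k r\<close> tests that \<open>r + golay_poly * q\<close> has weight at least \<open>k\<close> for every \<open>q\<close> of degree
  below \<open>n\<close>, where \<open>q = 0\<close> is exempt unless \<open>nz\<close>.
\<close>

private fun chk :: "nat \<Rightarrow> bool \<Rightarrow> nat \<Rightarrow> bool list \<Rightarrow> bool" where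
  "chk 0 nz k r = (nz \<longrightarrow> k \<le> count r)"
| "chk (Suc n) nz k r =
    ((case pop k r of (k', r') \<Rightarrow> chk n nz k' r') \<and>
     (case pop k (padd r gl) of (k', r') \<Rightarrow> chk n True k' r'))"

private lemma chk_12: "chk 12 False 7 []"
  by code_simp

private lemma to_poly_padd: "to_poly (padd xs ys) = to_poly xs + to_poly ys"
  by (induction xs ys rule: padd.induct) (auto simp: to_poly_def)

private lemma weight_pCons: "weight (coeff (pCons a p)) = of_bool (a \<noteq> 0) + weight (coeff p)"
proof -
  have fin: "finite {i. coeff p i \<noteq> 0}"
    using MOST_coeff_eq_0[of p] by (simp add: eventually_cofinite)
  have "{i. coeff (pCons a p) i \<noteq> 0} = (if a \<noteq> 0 then {0} else {}) \<union> Suc ` {i. coeff p i \<noteq> 0}"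
  proof (rule set_eqI)
    fix i
    show "i \<in> {i. coeff (pCons a p) i \<noteq> 0} \<longleftrightarrow>
        i \<in> (if a \<noteq> 0 then {0} else {}) \<union> Suc ` {i. coeff p i \<noteq> 0}"
      by (cases i) auto
  qed
  moreover have "card (Suc ` {i. coeff p i \<noteq> 0}) = card {i. coeff p i \<noteq> 0}"
    by (rule card_image) auto
  ultimately show ?thesis
    unfolding weight_def using fin by (auto simp: card_insert_if)
qed

private lemma weight_to_poly: "weight (coeff (to_poly xs)) = count xs"
proof (induction xs)
  case Nil
  then show ?case by (simp add: weight_def to_poly_def)
next
  case (Cons x xs)
  have "to_poly (x # xs) = pCons (of_bool x) (to_poly xs)" by (simp add: to_poly_def)
  with Cons show ?case by (simp only: weight_pCons count.simps) simp
qed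

private lemma pop_poly:
  assumes "pop k r = (k', r')" "k' \<le> weight (coeff (to_poly r' + p))"
  shows "k \<le> weight (coeff (to_poly r + pCons 0 p))"
proof (cases r)
  case Nil
  with assms show ?thesis
    by (simp add: to_poly_def weight_pCons)
next
  case (Cons x xs)
  then have "to_poly r + pCons 0 p = pCons (of_bool x) (to_poly xs + p)"
    by (simp add: to_poly_def)
  with assms Cons show ?thesis
    by (cases x) (simp_all only: weight_pCons pop.simps prod.inject if_True if_False, auto)
qed

private lemma to_poly_gl: "to_poly gl = golay_poly"
  by (simp add: to_poly_def gl_def golay_poly_def)

private lemma chk_sound:
  assumes "chk n nz k r" "\<forall>i\<ge>n. coeff q i = 0" "nz \<or> q \<noteq> 0"
  shows "k \<le> weight (coeff (to_poly r + golay_poly * q))"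
  using assms
proof (induction n arbitrary: nz k r q)
  case 0
  then have "q = 0" by (simp add: poly_eq_iff)
  with 0 show ?case by (simp add: weight_to_poly)
next
  case (Suc n)
  obtain a p where q: "q = pCons a p" by (cases q)
  have p: "\<forall>i\<ge>n. coeff p i = 0"
    using Suc.prems(2) unfolding q by (metis Suc_le_mono coeff_pCons_Suc)
  show ?case
  proof (cases "a = 0")
    case zero: True
    obtain k' r' where pop: "pop k r = (k', r')" by fastforce
    have k': "k' \<le> weight (coeff (to_poly r' + golay_poly * p))"
      using Suc.prems pop zero by (intro Suc.IH[OF _ p, of nz]) (auto simp: q)
    have "k \<le> weight (coeff (to_poly r + pCons 0 (golay_poly * p)))"
      by (rule pop_poly[OF pop k'])
    then show ?thesis
      by (simp only: q zero mult_pCons_right smult_0_left add_0_left)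
  next
    case False
    then have one: "a = 1" by simp
    obtain k' r' where pop: "pop k (padd r gl) = (k', r')" by fastforce
    have k': "k' \<le> weight (coeff (to_poly r' + golay_poly * p))"
      using Suc.prems pop by (intro Suc.IH[OF _ p, of True]) auto
    have "k \<le> weight (coeff (to_poly (padd r gl) + pCons 0 (golay_poly * p)))"
      by (rule pop_poly[OF pop k'])
    moreover have "golay_poly * q = golay_poly + pCons 0 (golay_poly * p)"
      by (simp only: q one mult_pCons_right smult_1_left)
    ultimately show ?thesis
      by (simp only: to_poly_padd to_poly_gl add.assoc)
  qed
qed

lemma golay23_min_weight:
  assumes "c \<in> golay23" "c \<noteq> 0"
  shows "7 \<le> weight c"
proof -
  from assms(1) obtain q where q: "degree q < 12" and c: "c = coeff (golay_poly * q)"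
    by (auto simp: golay23_alt)
  from assms(2) c have "q \<noteq> 0" by (auto simp: fun_eq_iff)
  moreover have "\<forall>i\<ge>12. coeff q i = 0" using q by (auto intro: coeff_eq_0)
  ultimately show ?thesis
    using chk_sound[OF chk_12, of q] by (simp add: c to_poly_def)
qed

lemma golay23_weight_7: "\<exists>c\<in>golay23. weight c = 7"
proof
  show "coeff golay_poly \<in> golay23"
    unfolding golay23_def by (rule imageI) (simp add: golay_poly_def del: mult_pCons_left)
  have "weight (coeff (to_poly gl)) = 7"
    unfolding weight_to_poly by (simp add: gl_def)
  then show "weight (coeff golay_poly) = 7" by (simp only: to_poly_gl)
qed

end

end

theory Submission
  imports Defs
begin

text \<open>
  Multiplication by the unit \<open>1 + u\<close> exchanges the two components of \<open>psi\<close>, and \<open>1\<close> and \<open>1 + u\<close>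
  generate the ring additively.  Hence a binary linear code is linear over the mixed alphabet with
  parameters \<open>(\<alpha>, \<beta>)\<close> iff it has an involutive automorphism with \<open>\<alpha>\<close> fixed points and \<open>\<beta>\<close> 2-cycles.

  The extended Golay code is self-dual and doubly even with minimum weight 8.  Let \<open>\<tau>\<close> be an
  involution of it and \<open>f\<close> the indicator of the set \<open>S\<close> of moved points.  For a codeword \<open>c\<close>, the
  weight of \<open>c + c \<circ> \<tau>\<close> is twice the number of 2-cycles on which \<open>c\<close> is not constant; it is
  divisible by 4, so that \<open>c\<close> is orthogonal to \<open>f\<close>.  By self-duality \<open>f\<close> is a codeword, and its
  weight is 8, 12, 16 or 24.  If it were less than 16, then \<open>c + c \<circ> \<tau>\<close>, being supported on \<open>S\<close>,
  would be \<open>0\<close> or \<open>f\<close> for every \<open>c\<close>; the union of two 2-cycles would then be orthogonal to all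
  codewords and thus a codeword of weight 4.  An involution of the Golay code of length 23 extends
  to length 24 with position 23 fixed, which leaves only \<open>\<beta> = 8\<close>.
\<close>

section \<open>Linearity as an involutive symmetry\<close>

text \<open>Sums and products of bits stay ring operations, so that ring and sum lemmas apply; the
  default rules rewrite them to \<open>XOR\<close> and \<open>AND\<close>.\<close>

declare add_bit_eq_xor [simp del] mult_bit_eq_and [simp del]

lemma bit_add_eq_0_iff: "x + y = 0 \<longleftrightarrow> x = y" for x y :: bit
  by (cases x; cases y) simp_all

text \<open>The permutation of binary positions that multiplication by \<open>1 + u_elt\<close>
  induces under \<open>Psi\<close>.\<close>

definition pair_swap :: "nat \<Rightarrow> nat \<Rightarrow> nat \<Rightarrow> nat" where
  "pair_swap \<alpha> \<beta> i =
     (if \<alpha> \<le> i \<and> i < \<alpha> + 2 * \<beta> then if even (i - \<alpha>) then i + 1 else i - 1 else i)"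

text \<open>The four kinds of position: a binary coordinate, either half of a pair, or beyond the
  word. Identities involving \<open>Psi\<close> and \<open>pair_swap\<close> are checked on each
  kind.\<close>

lemma mixed_index_cases:
  fixes i \<alpha> \<beta> :: nat
  obtains "i < \<alpha>"
  | j where "j < \<beta>" "i = \<alpha> + 2 * j"
  | j where "j < \<beta>" "i = \<alpha> + 2 * j + 1"
  | "\<alpha> + 2 * \<beta> \<le> i"
proof -
  consider "i < \<alpha>" | "\<alpha> + 2 * \<beta> \<le> i" | "\<alpha> \<le> i" "i < \<alpha> + 2 * \<beta>" by linarith
  then show thesis
  proof cases
    case 3
    define j where "j = (i - \<alpha>) div 2"
    have "i = \<alpha> + 2 * j \<or> i = \<alpha> + 2 * j + 1" "j < \<beta>"
      unfolding j_def using 3 by presburger+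
    then show thesis using that by blast
  qed (use that in blast)+
qed

lemma pair_swap_simps:
  "i < \<alpha> \<Longrightarrow> pair_swap \<alpha> \<beta> i = i"
  "j < \<beta> \<Longrightarrow> pair_swap \<alpha> \<beta> (\<alpha> + 2 * j) = \<alpha> + 2 * j + 1"
  "j < \<beta> \<Longrightarrow> pair_swap \<alpha> \<beta> (\<alpha> + 2 * j + 1) = \<alpha> + 2 * j"
  "\<alpha> + 2 * \<beta> \<le> i \<Longrightarrow> pair_swap \<alpha> \<beta> i = i"
  by (simp_all add: pair_swap_def)

lemma pair_swap_involution: "pair_swap \<alpha> \<beta> \<circ> pair_swap \<alpha> \<beta> = id"
proof (rule ext)
  show "(pair_swap \<alpha> \<beta> \<circ> pair_swap \<alpha> \<beta>) i = id i" for i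
    \<comment> \<open>Positions keep the form \<open>\<alpha> + 2 * j + 1\<close>, in which the
      evaluation rules are stated, instead of becoming successors.\<close>
    by (rule mixed_index_cases[of i \<alpha> _ \<beta>])
      (simp_all add: pair_swap_simps del: add_Suc_right One_nat_def)
qed

lemma involution_permutes:
  assumes inv: "\<tau> \<circ> \<tau> = id" and fixed: "\<And>i. i \<notin> A \<Longrightarrow> \<tau> i = i"
  shows "\<tau> permutes A"
proof (rule bij_imp_permutes)
  have [simp]: "\<tau> (\<tau> i) = i" for i using inv by (simp add: fun_eq_iff)
  have "\<tau> i \<in> A" if "i \<in> A" for i
    using that fixed[of "\<tau> i"] by (cases "\<tau> i \<in> A") simp_all
  then show "bij_betw \<tau> A A"
    by (intro bij_betw_byWitness[where f' = \<tau>]) auto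
qed (rule fixed)

lemma pair_swap_permutes: "pair_swap \<alpha> \<beta> permutes {..<\<alpha> + 2 * \<beta>}"
  by (rule involution_permutes[OF pair_swap_involution]) (simp add: pair_swap_def)

lemma pair_swap_moved: "{i. pair_swap \<alpha> \<beta> i \<noteq> i} = {\<alpha>..<\<alpha> + 2 * \<beta>}"
  by (auto simp: pair_swap_def) presburger+

text \<open>The table of \<open>psi\<close> is linear over the two-element field, which makes the
  additivity of \<open>Psi\<close> and the inverse of \<open>psi\<close> immediate.\<close>

lemma psi_eq: "psi x = (u_part x, re_part x + u_part x)"
  by (cases x; cases "re_part x"; cases "u_part x") (simp_all add: psi_def z2u_defs)

lemma Psi_simps:
  "i < \<alpha> \<Longrightarrow> Psi \<alpha> \<beta> v i = fst v i"
  "j < \<beta> \<Longrightarrow> Psi \<alpha> \<beta> v (\<alpha> + 2 * j) = u_part (snd v j)"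
  "j < \<beta> \<Longrightarrow> Psi \<alpha> \<beta> v (\<alpha> + 2 * j + 1) = re_part (snd v j) + u_part (snd v j)"
  "\<alpha> + 2 * \<beta> \<le> i \<Longrightarrow> Psi \<alpha> \<beta> v i = 0"
  by (simp_all add: Psi_def psi_eq)

lemma Psi_0: "Psi \<alpha> \<beta> 0 = 0"
proof (rule ext)
  show "Psi \<alpha> \<beta> 0 i = 0 i" for i
    by (rule mixed_index_cases[of i \<alpha> _ \<beta>])
      (simp_all add: Psi_simps zero_z2u_def del: add_Suc_right One_nat_def)
qed

lemma Psi_add: "Psi \<alpha> \<beta> (v + w) = Psi \<alpha> \<beta> v + Psi \<alpha> \<beta> w"
proof (rule ext)
  show "Psi \<alpha> \<beta> (v + w) i = (Psi \<alpha> \<beta> v + Psi \<alpha> \<beta> w) i" for i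
    by (rule mixed_index_cases[of i \<alpha> _ \<beta>])
      (simp_all add: Psi_simps plus_z2u_def del: add_Suc_right One_nat_def)
qed

text \<open>The unit sends \<open>a + b u\<close> to \<open>a + (a + b) u\<close>, so the pair
  \<open>(b, a + b)\<close> becomes \<open>(a + b, b)\<close>; binary coordinates stay because
  \<open>pi_map (1 + u_elt) = 1\<close>.\<close>

lemma Psi_scale_unit:
  "Psi \<alpha> \<beta> (mixed_scale (1 + u_elt) v) = Psi \<alpha> \<beta> v \<circ> pair_swap \<alpha> \<beta>"
proof (rule ext)
  show "Psi \<alpha> \<beta> (mixed_scale (1 + u_elt) v) i = (Psi \<alpha> \<beta> v \<circ> pair_swap \<alpha> \<beta>) i" for i
    by (rule mixed_index_cases[of i \<alpha> _ \<beta>])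
      (simp_all add: Psi_simps pair_swap_simps mixed_scale_def pi_map_def
        one_z2u_def u_elt_def plus_z2u_def times_z2u_def
        del: add_Suc_right One_nat_def)
qed

lemma Psi_surj:
  assumes "x \<in> words (\<alpha> + 2 * \<beta>)"
  obtains v where "v \<in> mixed_words \<alpha> \<beta>" "Psi \<alpha> \<beta> v = x"
proof
  \<comment> \<open>A pair \<open>(p, q)\<close> is \<open>psi (Dual (p + q) p)\<close>.\<close>
  let ?v = "(\<lambda>i. if i < \<alpha> then x i else 0,
    \<lambda>j. if j < \<beta> then Dual (x (\<alpha> + 2 * j) + x (\<alpha> + 2 * j + 1)) (x (\<alpha> + 2 * j)) else 0)"
  show "?v \<in> mixed_words \<alpha> \<beta>"
    by (simp add: mixed_words_def words_def)
  show "Psi \<alpha> \<beta> ?v = x"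
  proof (rule ext)
    show "Psi \<alpha> \<beta> ?v i = x i" for i
      using assms by (cases rule: mixed_index_cases[of i \<alpha> _ \<beta>])
        (simp_all add: Psi_simps words_def del: add_Suc_right One_nat_def)
  qed
qed

lemma words_comp:
  assumes "x \<in> words n" "\<sigma> permutes {..<n}"
  shows "x \<circ> \<sigma> \<in> words n"
  using assms by (auto simp: words_def permutes_not_in)

section \<open>Involutions with finitely many moved points, and their conjugacy\<close>

lemma involution_halves:
  fixes \<tau> :: "nat \<Rightarrow> nat"
  assumes "\<tau> \<circ> \<tau> = id" "finite {i. \<tau> i \<noteq> i}"
  shows "{i. \<tau> i \<noteq> i} = {i. i < \<tau> i} \<union> \<tau> ` {i. i < \<tau> i}"
    and "{i. i < \<tau> i} \<inter> \<tau> ` {i. i < \<tau> i} = {}"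
    and "finite {i. i < \<tau> i}"
    and "inj \<tau>"
proof -
  have [simp]: "\<tau> (\<tau> i) = i" for i
    using assms(1) by (simp add: fun_eq_iff)
  show "{i. \<tau> i \<noteq> i} = {i. i < \<tau> i} \<union> \<tau> ` {i. i < \<tau> i}"
  proof (intro set_eqI iffI)
    fix i assume "i \<in> {i. \<tau> i \<noteq> i}"
    then have "i < \<tau> i \<or> \<tau> i < \<tau> (\<tau> i)" by auto
    then show "i \<in> {i. i < \<tau> i} \<union> \<tau> ` {i. i < \<tau> i}"
      by (auto intro: image_eqI[where x = "\<tau> i"])
  qed force
  show "{i. i < \<tau> i} \<inter> \<tau> ` {i. i < \<tau> i} = {}" by auto
  show "finite {i. i < \<tau> i}"
    by (rule finite_subset[OF _ assms(2)]) auto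
  show "inj \<tau>" by (rule inj_on_inverseI[where g = \<tau>]) simp
qed

text \<open>The smaller point of each 2-cycle represents it. A constant \<open>f\<close> counts the
  2-cycles; a word \<open>f\<close> has its sum over the moved points regrouped by cycles.\<close>

lemma sum_involution:
  fixes \<tau> :: "nat \<Rightarrow> nat"
  assumes "\<tau> \<circ> \<tau> = id" "finite {i. \<tau> i \<noteq> i}"
  shows "(\<Sum>i | \<tau> i \<noteq> i. f i) = (\<Sum>i | i < \<tau> i. f i + f (\<tau> i))"
  unfolding involution_halves(1)[OF assms]
  using involution_halves(2-4)[OF assms]
  by (subst sum.union_disjoint) (auto simp: sum.reindex inj_on_subset sum.distrib)

lemma card_involution_half:
  fixes \<tau> :: "nat \<Rightarrow> nat"
  assumes "\<tau> \<circ> \<tau> = id" "card {i. \<tau> i \<noteq> i} = 2 * \<beta>" "finite {i. \<tau> i \<noteq> i}"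
  shows "card {i. i < \<tau> i} = \<beta>"
  using sum_involution[OF assms(1,3), of "\<lambda>_. 1 :: nat"] assms(2) by simp

text \<open>Involutions of the same cycle type are conjugate: \<open>\<sigma>\<close> carries the
  first \<alpha> positions to an enumeration of the fixed points of \<open>\<tau>\<close>, and the
  consecutive pairs to an enumeration of its 2-cycles.\<close>

lemma involution_conjugate_pair_swap:
  fixes \<tau> :: "nat \<Rightarrow> nat"
  assumes perm: "\<tau> permutes {..<\<alpha> + 2 * \<beta>}" and inv: "\<tau> \<circ> \<tau> = id"
    and card: "card {i. \<tau> i \<noteq> i} = 2 * \<beta>"
  obtains \<sigma> where "\<sigma> permutes {..<\<alpha> + 2 * \<beta>}" "\<sigma> \<circ> pair_swap \<alpha> \<beta> = \<tau> \<circ> \<sigma>"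
proof -
  let ?n = "\<alpha> + 2 * \<beta>"
  let ?F = "{i \<in> {..<?n}. \<tau> i = i}" and ?H = "{i. i < \<tau> i}"
  have moved: "{i. \<tau> i \<noteq> i} \<subseteq> {..<?n}"
    using perm by (auto simp: permutes_def)
  then have fin: "finite {i. \<tau> i \<noteq> i}" by (rule finite_subset) simp
  have [simp]: "\<tau> (\<tau> i) = i" for i
    using inv by (simp add: fun_eq_iff)
  have "?F = {..<?n} - {i. \<tau> i \<noteq> i}" by auto
  then have "card ?F = \<alpha>"
    using moved fin card by (simp add: card_Diff_subset)
  then obtain f where f: "bij_betw f {0..<\<alpha>} ?F"
    using ex_bij_betw_nat_finite[of ?F] by auto
  obtain h where h: "bij_betw h {0..<\<beta>} ?H"
    using ex_bij_betw_nat_finite[OF involution_halves(3)[OF inv fin]]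
    by (auto simp: card_involution_half[OF inv card fin])
  have f': "f i < ?n" "\<tau> (f i) = f i" if "i < \<alpha>" for i
    using bij_betwE[OF f] that by auto
  have f_inj: "f i = f i' \<longleftrightarrow> i = i'" if "i < \<alpha>" "i' < \<alpha>" for i i'
    using f that by (auto simp: bij_betw_def inj_on_def)
  have h': "h j < \<tau> (h j)" "h j < ?n" "\<tau> (h j) < ?n" if "j < \<beta>" for j
  proof -
    show *: "h j < \<tau> (h j)" using bij_betwE[OF h] that by auto
    then have "\<tau> (h j) \<noteq> h j" "\<tau> (\<tau> (h j)) \<noteq> \<tau> (h j)" by auto
    then show "h j < ?n" "\<tau> (h j) < ?n" using moved by blast+
  qed
  have h_inj: "h j = h j' \<longleftrightarrow> j = j'" if "j < \<beta>" "j' < \<beta>" for j j'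
    using h that by (auto simp: bij_betw_def inj_on_def)
  have \<tau>_inj: "\<tau> i = \<tau> i' \<longleftrightarrow> i = i'" for i i'
    using involution_halves(4)[OF inv fin] by (auto simp: inj_def)
  define \<sigma> where "\<sigma> i = (if i < \<alpha> then f i else if i < ?n then
    (if even (i - \<alpha>) then h ((i - \<alpha>) div 2) else \<tau> (h ((i - \<alpha>) div 2))) else i)" for i
  have \<sigma>_simps: "i < \<alpha> \<Longrightarrow> \<sigma> i = f i" "j < \<beta> \<Longrightarrow> \<sigma> (\<alpha> + 2 * j) = h j"
    "j < \<beta> \<Longrightarrow> \<sigma> (\<alpha> + 2 * j + 1) = \<tau> (h j)" "?n \<le> i \<Longrightarrow> \<sigma> i = i" for i j
    by (simp_all add: \<sigma>_def)
  note simps = \<sigma>_simps pair_swap_simps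
  have range: "\<sigma> i < ?n" if "i < ?n" for i
    using that by (cases rule: mixed_index_cases[of i \<alpha> _ \<beta>])
      (simp_all add: \<sigma>_simps f' h' del: add_Suc_right One_nat_def)
  have cross: "f i \<noteq> h j" "f i \<noteq> \<tau> (h j)" if "i < \<alpha>" "j < \<beta>" for i j
    using f'(2)[OF that(1)] h'(1)[OF that(2)] by auto
  \<comment> \<open>If \<open>h j = \<tau> (h j')\<close>, then
    \<open>\<tau> (h j) = h j' < h j\<close>, against the choice of \<open>h j\<close> as the
    smaller point of its cycle.\<close>
  have cross': "h j \<noteq> \<tau> (h j')" if "j < \<beta>" "j' < \<beta>" for j j'
    using h'(1)[OF that(1)] h'(1)[OF that(2)] by auto
  have inj: "i = i'" if "i < ?n" "i' < ?n" "\<sigma> i = \<sigma> i'" for i i'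
    using that cross cross' cross[symmetric] cross'[symmetric]
    by (cases rule: mixed_index_cases[of i \<alpha> _ \<beta>];
        cases rule: mixed_index_cases[of i' \<alpha> _ \<beta>])
      (simp_all add: \<sigma>_simps f_inj h_inj \<tau>_inj del: add_Suc_right One_nat_def)
  have "\<sigma> permutes {..<?n}"
  proof (rule bij_imp_permutes)
    have "inj_on \<sigma> {..<?n}" using inj by (auto intro!: inj_onI)
    moreover have "\<sigma> ` {..<?n} \<subseteq> {..<?n}" using range by auto
    ultimately show "bij_betw \<sigma> {..<?n} {..<?n}"
      by (simp add: bij_betw_def endo_inj_surj)
  qed (simp add: \<sigma>_simps)
  moreover have "\<sigma> \<circ> pair_swap \<alpha> \<beta> = \<tau> \<circ> \<sigma>"
  proof (rule ext)
    fix i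
    have "\<tau> i = i" if "?n \<le> i" using perm that by (simp add: permutes_not_in)
    then show "(\<sigma> \<circ> pair_swap \<alpha> \<beta>) i = (\<tau> \<circ> \<sigma>) i"
      by (cases rule: mixed_index_cases[of i \<alpha> _ \<beta>])
        (simp_all add: simps f' del: add_Suc_right One_nat_def)
  qed
  ultimately show thesis by (rule that)
qed

section \<open>Additive codes and codes invariant under an involution\<close>

lemma additive_code_closed:
  assumes "additive_code \<alpha> \<beta> D"
  shows "0 \<in> D" "v \<in> D \<Longrightarrow> w \<in> D \<Longrightarrow> v + w \<in> D" "v \<in> D \<Longrightarrow> mixed_scale c v \<in> D"
  using assms by (auto simp: additive_code_def mixed.subspace_def)

text \<open>The permutation of coordinates is absorbed by conjugating \<open>pair_swap\<close>. An
  additively closed set containing \<open>0\<close> and stable under the unit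
  \<open>1 + u_elt\<close> is a submodule, since the only other nontrivial scalar is
  \<open>u_elt = 1 + (1 + u_elt)\<close>.\<close>

lemma z2z2u_linear_iff_involution:
  "z2z2u_linear n C \<alpha> \<beta> \<longleftrightarrow>
     n = \<alpha> + 2 * \<beta> \<and> C \<subseteq> words n \<and> 0 \<in> C \<and> (\<forall>c\<in>C. \<forall>d\<in>C. c + d \<in> C) \<and>
     (\<exists>\<tau>. \<tau> permutes {..<n} \<and> \<tau> \<circ> \<tau> = id \<and> card {i. \<tau> i \<noteq> i} = 2 * \<beta> \<and> (\<forall>c\<in>C. c \<circ> \<tau> \<in> C))"
  (is "?L \<longleftrightarrow> ?R")
proof
  assume ?L
  then obtain \<sigma> D where n: "n = \<alpha> + 2 * \<beta>" and C: "C \<subseteq> words n" and \<sigma>: "\<sigma> permutes {..<n}"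
    and D: "additive_code \<alpha> \<beta> D" and eq: "(\<lambda>c. c \<circ> \<sigma>) ` C = Psi \<alpha> \<beta> ` D"
    unfolding z2z2u_linear_def by blast
  let ?s = "pair_swap \<alpha> \<beta>"
  have \<sigma>_inv: "\<sigma> \<circ> inv \<sigma> = id" "inv \<sigma> \<circ> \<sigma> = id"
    using permutes_inv_o[OF \<sigma>] by auto
  have C_iff: "c \<in> C \<longleftrightarrow> c \<circ> \<sigma> \<in> Psi \<alpha> \<beta> ` D" for c
  proof -
    have "inj (\<lambda>c :: nat \<Rightarrow> bit. c \<circ> \<sigma>)"
      by (rule inj_on_inverseI[where g = "\<lambda>c. c \<circ> inv \<sigma>"]) (simp add: comp_assoc \<sigma>_inv)
    from inj_image_mem_iff[OF this, of c C] show ?thesis unfolding eq by simp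
  qed
  have "0 \<in> C"
  proof -
    have "0 \<circ> \<sigma> = Psi \<alpha> \<beta> 0" by (simp add: Psi_0 fun_eq_iff)
    then show ?thesis
      unfolding C_iff by (rule image_eqI[OF _ additive_code_closed(1)[OF D]])
  qed
  moreover have "c + d \<in> C" if "c \<in> C" "d \<in> C" for c d
  proof -
    from that obtain v w where vw: "v \<in> D" "w \<in> D"
      and eq: "c \<circ> \<sigma> = Psi \<alpha> \<beta> v" "d \<circ> \<sigma> = Psi \<alpha> \<beta> w"
      unfolding C_iff by blast
    have "(c + d) \<circ> \<sigma> = (c \<circ> \<sigma>) + (d \<circ> \<sigma>)" by (simp add: fun_eq_iff)
    then have "(c + d) \<circ> \<sigma> = Psi \<alpha> \<beta> (v + w)" by (simp only: eq Psi_add)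
    then show ?thesis
      unfolding C_iff by (rule image_eqI[OF _ additive_code_closed(2)[OF D vw]])
  qed
  moreover have "\<exists>\<tau>. \<tau> permutes {..<n} \<and> \<tau> \<circ> \<tau> = id \<and> card {i. \<tau> i \<noteq> i} = 2 * \<beta> \<and> (\<forall>c\<in>C. c \<circ> \<tau> \<in> C)"
  proof (intro exI conjI ballI)
    \<comment> \<open>The action of the unit, transported back to the coordinates of
      \<open>C\<close>.\<close>
    let ?\<tau> = "\<sigma> \<circ> ?s \<circ> inv \<sigma>"
    show "?\<tau> permutes {..<n}"
      using \<sigma> pair_swap_permutes[of \<alpha> \<beta>] by (auto simp: n intro!: permutes_compose permutes_inv)
    have "?\<tau> \<circ> ?\<tau> = \<sigma> \<circ> ?s \<circ> (inv \<sigma> \<circ> \<sigma>) \<circ> ?s \<circ> inv \<sigma>" by (simp only: comp_assoc)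
    also have "\<dots> = \<sigma> \<circ> (?s \<circ> ?s) \<circ> inv \<sigma>" by (simp only: \<sigma>_inv comp_id comp_assoc)
    also have "\<dots> = id" by (simp only: pair_swap_involution comp_id \<sigma>_inv)
    finally show "?\<tau> \<circ> ?\<tau> = id" .
    have inj: "inj \<sigma>" using permutes_inj[OF \<sigma>] .
    have "?\<tau> i \<noteq> i \<longleftrightarrow> ?s (inv \<sigma> i) \<noteq> inv \<sigma> i" for i
      using inj_eq[OF inj, of "?s (inv \<sigma> i)" "inv \<sigma> i"] permutes_inverses(1)[OF \<sigma>] by simp
    then have "{i. ?\<tau> i \<noteq> i} = \<sigma> ` {i. ?s i \<noteq> i}"
      using permutes_inverses[OF \<sigma>] by (auto intro!: image_eqI[where x = "inv \<sigma> _"])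
    then show "card {i. ?\<tau> i \<noteq> i} = 2 * \<beta>"
      by (simp add: pair_swap_moved card_image inj_on_subset[OF inj])
    fix c assume "c \<in> C"
    then obtain v where v: "v \<in> D" "c \<circ> \<sigma> = Psi \<alpha> \<beta> v" unfolding C_iff by blast
    have "c \<circ> ?\<tau> \<circ> \<sigma> = c \<circ> \<sigma> \<circ> ?s \<circ> (inv \<sigma> \<circ> \<sigma>)" by (simp only: comp_assoc)
    also have "\<dots> = Psi \<alpha> \<beta> (mixed_scale (1 + u_elt) v)"
      by (simp only: \<sigma>_inv comp_id v Psi_scale_unit)
    finally show "c \<circ> ?\<tau> \<in> C"
      unfolding C_iff using additive_code_closed(3)[OF D v(1)] by blast
  qed
  ultimately show ?R using n C by blast
next
  assume ?R
  then obtain \<tau> where n: "n = \<alpha> + 2 * \<beta>" and C: "C \<subseteq> words n" "0 \<in> C"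
    and add: "\<And>c d. c \<in> C \<Longrightarrow> d \<in> C \<Longrightarrow> c + d \<in> C"
    and \<tau>: "\<tau> permutes {..<n}" "\<tau> \<circ> \<tau> = id" "card {i. \<tau> i \<noteq> i} = 2 * \<beta>"
    and inv: "\<And>c. c \<in> C \<Longrightarrow> c \<circ> \<tau> \<in> C" by blast
  let ?s = "pair_swap \<alpha> \<beta>"
  obtain \<sigma> where \<sigma>: "\<sigma> permutes {..<n}" and conj: "\<sigma> \<circ> ?s = \<tau> \<circ> \<sigma>"
    using involution_conjugate_pair_swap[of \<tau> \<alpha> \<beta>] \<tau> unfolding n by blast
  \<comment> \<open>The preimage of the permuted code; by \<open>Psi_surj\<close> its image is that
    whole code.\<close>
  define D where "D = {v \<in> mixed_words \<alpha> \<beta>. Psi \<alpha> \<beta> v \<in> (\<lambda>c. c \<circ> \<sigma>) ` C}"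
  have "(\<lambda>c. c \<circ> \<sigma>) ` C \<subseteq> Psi \<alpha> \<beta> ` D"
  proof
    fix x assume x: "x \<in> (\<lambda>c. c \<circ> \<sigma>) ` C"
    then have "x \<in> words (\<alpha> + 2 * \<beta>)" using C(1) words_comp[OF _ \<sigma>] unfolding n by blast
    then obtain v where v: "v \<in> mixed_words \<alpha> \<beta>" "Psi \<alpha> \<beta> v = x"
      by (rule Psi_surj)
    with x have "v \<in> D" unfolding D_def by blast
    with v show "x \<in> Psi \<alpha> \<beta> ` D" by blast
  qed
  then have image: "(\<lambda>c. c \<circ> \<sigma>) ` C = Psi \<alpha> \<beta> ` D" unfolding D_def by blast
  have D0: "0 \<in> D"
  proof -
    have "Psi \<alpha> \<beta> 0 = 0 \<circ> \<sigma>" by (simp add: Psi_0 fun_eq_iff)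
    then show ?thesis
      using C(2) mixed.subspace_0[OF mixed_words_subspace] unfolding D_def by blast
  qed
  have D_add: "v + w \<in> D" if "v \<in> D" "w \<in> D" for v w
  proof -
    from that obtain c d where "c \<in> C" "d \<in> C" "Psi \<alpha> \<beta> v = c \<circ> \<sigma>" "Psi \<alpha> \<beta> w = d \<circ> \<sigma>"
      unfolding D_def by blast
    then have "Psi \<alpha> \<beta> (v + w) = (c + d) \<circ> \<sigma>" "c + d \<in> C"
      by (simp_all add: Psi_add fun_eq_iff add)
    moreover have "v + w \<in> mixed_words \<alpha> \<beta>"
      using that mixed.subspace_add[OF mixed_words_subspace] unfolding D_def by blast
    ultimately show ?thesis unfolding D_def by blast
  qed
  have D_unit: "mixed_scale (1 + u_elt) v \<in> D" if "v \<in> D" for v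
  proof -
    from that obtain c where c: "c \<in> C" "Psi \<alpha> \<beta> v = c \<circ> \<sigma>"
      unfolding D_def by blast
    then have "Psi \<alpha> \<beta> (mixed_scale (1 + u_elt) v) = (c \<circ> \<tau>) \<circ> \<sigma>"
      by (simp only: Psi_scale_unit comp_assoc conj)
    moreover have "mixed_scale (1 + u_elt) v \<in> mixed_words \<alpha> \<beta>"
      using that mixed.subspace_scale[OF mixed_words_subspace] unfolding D_def by blast
    ultimately show ?thesis using inv[OF c(1)] unfolding D_def by blast
  qed
  have D_scale: "mixed_scale a v \<in> D" if "v \<in> D" for a v
  proof -
    have "1 + (1 + u_elt) = u_elt" by (simp add: z2u_defs)
    then have "mixed_scale u_elt v = v + mixed_scale (1 + u_elt) v"
      using mixed.scale_left_distrib[of 1 "1 + u_elt" v] by (simp only: mixed.scale_one)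
    moreover have "a \<in> {0, 1, u_elt, 1 + u_elt}" using UNIV_z2u by auto
    ultimately show ?thesis
      using D0 D_unit[OF that] D_add[OF that D_unit[OF that]] that by auto
  qed
  have "additive_code \<alpha> \<beta> D"
    unfolding additive_code_def mixed.subspace_def
    using D0 D_add D_scale by (auto simp: D_def)
  then show ?L
    unfolding z2z2u_linear_def using n C(1) \<sigma> image by blast
qed

section \<open>Parity checks of the extended Golay code\<close>

text \<open>For \<open>i < 12\<close>, the generator polynomial shifted by \<open>i\<close>: the
  listed numbers are the exponents occurring in \<open>golay_poly\<close>. They are seven, an odd
  number, so the parity bit at position 23 is set.\<close>

definition golay_row :: "nat \<Rightarrow> nat \<Rightarrow> bit" where
  "golay_row i j = of_bool (j \<in> insert 23 ((+) i ` {0, 2, 4, 5, 6, 10, 11}))"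

definition word_dot :: "(nat \<Rightarrow> bit) \<Rightarrow> (nat \<Rightarrow> bit) \<Rightarrow> bit" where
  "word_dot c d = (\<Sum>j<24. c j * d j)"

text \<open>For \<open>i < 12\<close>, the inner product with row \<open>i\<close> as an explicit
  sum, which can be evaluated by computation or solved for a single entry.\<close>

definition golay_check :: "(nat \<Rightarrow> bit) \<Rightarrow> nat \<Rightarrow> bit" where
  "golay_check c i =
    c i + c (i + 2) + c (i + 4) + c (i + 5) + c (i + 6) + c (i + 10) + c (i + 11) + c 23"

lemma all_less_numeral:
  "(\<forall>i<numeral k. P i) \<longleftrightarrow> (\<forall>i\<in>set [0..<numeral k]. P i)" for P :: "nat \<Rightarrow> bool"
  by auto

section \<open>Generating rows of the extended code\<close>

lemma coeff_golay_poly: "coeff golay_poly k = of_bool (k \<in> {0, 2, 4, 5, 6, 10, 11})"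
  unfolding golay_poly_def by (simp add: coeff_pCons numeral_eq_Suc split: nat.split)

text \<open>Linear in the message polynomial, parity bit included, so that the images of the
  monomials span the code.\<close>

definition golay_encode :: "bit poly \<Rightarrow> nat \<Rightarrow> bit" where
  "golay_encode q = (coeff (golay_poly * q))(23 := (\<Sum>i<23. coeff (golay_poly * q) i))"

lemma golay24_eq_encode: "golay24 = golay_encode ` {q. degree q < 12}"
  unfolding golay24_def golay23_alt image_image golay_encode_def ..

lemma golay_encode_add: "golay_encode (p + q) = golay_encode p + golay_encode q"
  by (simp add: golay_encode_def fun_eq_iff distrib_left sum.distrib)

lemma golay_encode_0: "golay_encode 0 = 0"
  by (simp add: golay_encode_def fun_eq_iff)

lemma golay_encode_sum: "golay_encode (sum f A) = (\<Sum>a\<in>A. golay_encode (f a))"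
  by (induction A rule: infinite_finite_induct) (simp_all add: golay_encode_0 golay_encode_add)

lemma golay_encode_monom:
  assumes "i < 12"
  shows "golay_encode (monom 1 i) = golay_row i"
proof -
  have coeff: "coeff (golay_poly * monom 1 i) j = of_bool (j \<in> (+) i ` {0, 2, 4, 5, 6, 10, 11})" for j
  proof -
    have "j \<in> (+) i ` K \<longleftrightarrow> i \<le> j \<and> j - i \<in> K" for K
      by (auto simp: image_iff intro!: bexI[of _ "j - i"])
    then show ?thesis
      by (simp add: mult.commute[of golay_poly] coeff_monom_mult coeff_golay_poly del: image_insert)
  qed
  have "\<forall>i<12::nat. (\<Sum>j<23::nat. of_bool (j \<in> (+) i ` {0, 2, 4, 5, 6, 10, 11})) = (1 :: bit)"
    unfolding all_less_numeral
    by (simp add: upt_rec lessThan_nat_numeral lessThan_Suc)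
  with assms have "(\<Sum>j<23. coeff (golay_poly * monom 1 i) j) = 1"
    unfolding coeff by blast
  then show ?thesis
    using assms by (auto simp: golay_encode_def golay_row_def fun_eq_iff coeff)
qed

text \<open>Over the two-element field a linear combination is a sum over a subset; here the subset
  is the support of the message polynomial.\<close>

lemma golay24_eq_span: "golay24 = (\<lambda>A. \<Sum>i\<in>A. golay_row i) ` Pow {..<12}"
proof (intro subset_antisym subsetI)
  fix c assume "c \<in> golay24"
  then obtain q where q: "degree q < 12" "c = golay_encode q"
    unfolding golay24_eq_encode by blast
  let ?A = "{i. coeff q i \<noteq> 0}"
  have A: "?A \<subseteq> {..<12}"
    using q(1) le_degree[of q] by (auto intro: le_less_trans)
  then have fin: "finite ?A" by (rule finite_subset) simp
  have "q = (\<Sum>i\<in>?A. monom 1 i)"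
    using fin by (intro poly_eqI) (auto simp: coeff_sum)
  then have "golay_encode q = golay_encode (\<Sum>i\<in>?A. monom 1 i)" by (rule arg_cong)
  then have "c = (\<Sum>i\<in>?A. golay_encode (monom 1 i))"
    unfolding q(2)[symmetric] golay_encode_sum .
  also have "\<dots> = (\<Sum>i\<in>?A. golay_row i)"
    using A by (intro sum.cong) (auto simp: golay_encode_monom)
  finally show "c \<in> (\<lambda>A. \<Sum>i\<in>A. golay_row i) ` Pow {..<12}"
    using A by blast
next
  fix c assume "c \<in> (\<lambda>A. \<Sum>i\<in>A. golay_row i) ` Pow {..<12}"
  then obtain A where A: "A \<subseteq> {..<12}" "c = (\<Sum>i\<in>A. golay_row i)" by blast
  have "c = (\<Sum>i\<in>A. golay_encode (monom 1 i))"
    unfolding A(2) using A(1) by (intro sum.cong) (auto simp: golay_encode_monom)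
  then have "c = golay_encode (\<Sum>i\<in>A. monom 1 i)" by (simp add: golay_encode_sum)
  moreover have "degree (\<Sum>i\<in>A. monom 1 i :: bit poly) < 12"
    using A(1) by (intro degree_sum_less) (auto simp: degree_monom_eq)
  ultimately show "c \<in> golay24" unfolding golay24_eq_encode by blast
qed

lemma golay24_zero: "0 \<in> golay24"
  unfolding golay24_eq_span by (rule image_eqI[of _ _ "{}"]) auto

lemma golay_row_in_golay24: "i < 12 \<Longrightarrow> golay_row i \<in> golay24"
  unfolding golay24_eq_span by (rule image_eqI[of _ _ "{i}"]) auto

lemma golay24_add:
  assumes "c \<in> golay24" "d \<in> golay24"
  shows "c + d \<in> golay24"
proof -
  from assms obtain p q where "degree p < 12" "degree q < 12"
    "c = golay_encode p" "d = golay_encode q"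
    unfolding golay24_eq_encode by blast
  then show ?thesis
    unfolding golay24_eq_encode
    by (intro image_eqI[of _ _ "p + q"]) (simp_all add: golay_encode_add degree_add_less)
qed

text \<open>Extends to the whole code what survives the addition of one row. This also serves for
  the weight modulo 4, which is not linear.\<close>

lemma golay24_induct [consumes 1, case_names zero add]:
  fixes P :: "(nat \<Rightarrow> bit) \<Rightarrow> bool"
  assumes "c \<in> golay24" "P 0"
    and "\<And>i c. i < 12 \<Longrightarrow> c \<in> golay24 \<Longrightarrow> P c \<Longrightarrow> P (golay_row i + c)"
  shows "P c"
proof -
  obtain A where A: "A \<subseteq> {..<12}" "c = (\<Sum>i\<in>A. golay_row i)"
    using assms(1) unfolding golay24_eq_span by blast
  have "finite A" using A(1) by (rule finite_subset) simp
  then have "(\<Sum>i\<in>A. golay_row i) \<in> golay24 \<and> P (\<Sum>i\<in>A. golay_row i)"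
    using A(1) by (induction A)
      (auto simp: assms golay24_zero intro!: golay24_add golay_row_in_golay24)
  then show ?thesis using A(2) by simp
qed

lemma golay24_subset_words: "golay24 \<subseteq> words 24"
  using golay23_subset_words by (auto simp: golay24_def words_def)

section \<open>The inner product and self-duality\<close>

lemma word_dot_add_left: "word_dot (c + d) e = word_dot c e + word_dot d e"
  by (simp add: word_dot_def distrib_right sum.distrib)

lemma word_dot_add_right: "word_dot c (d + e) = word_dot c d + word_dot c e"
  by (simp add: word_dot_def distrib_left sum.distrib)

lemma word_dot_zero: "word_dot 0 c = 0" "word_dot c 0 = 0"
  by (simp_all add: word_dot_def)

lemma word_dot_commute: "word_dot c d = word_dot d c"
  by (simp add: word_dot_def mult.commute)

lemma word_dot_golay_row:
  assumes "i < 12"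
  shows "word_dot (golay_row i) c = golay_check c i"
proof -
  let ?S = "insert 23 ((+) i ` {0, 2, 4, 5, 6, 10, 11})"
  have "word_dot (golay_row i) c = (\<Sum>j\<in>?S. c j)"
    unfolding word_dot_def
  proof (rule sum.mono_neutral_cong_right)
    show "\<forall>j\<in>{..<24} - ?S. golay_row i j * c j = 0"
      by (simp add: golay_row_def)
  qed (use assms in \<open>auto simp: golay_row_def\<close>)
  also have "\<dots> = golay_check c i"
    unfolding golay_check_def using assms by (simp add: add.assoc ac_simps)
  finally show ?thesis .
qed

lemma word_dot_golay_rows:
  assumes "i < 12" "k < 12"
  shows "word_dot (golay_row i) (golay_row k) = 0"
proof -
  \<comment> \<open>The 144 inner products, including those of a row with itself, are
    computed.\<close>
  have "\<forall>i\<in>set [0..<12]. \<forall>k\<in>set [0..<12]. golay_check (golay_row k) i = 0"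
    by code_simp
  with assms show ?thesis by (simp add: word_dot_golay_row)
qed

lemma orthogonal_golay24I:
  assumes "\<And>i. i < 12 \<Longrightarrow> word_dot (golay_row i) c = 0" "d \<in> golay24"
  shows "word_dot d c = 0"
  using assms(2)
proof (induction rule: golay24_induct)
  case (add i d)
  show "word_dot (golay_row i + d) c = 0"
    using add assms(1) by (simp add: word_dot_add_left)
qed (rule word_dot_zero)

text \<open>Orthogonality of the rows passes to the code by linearity in one argument after the
  other.\<close>

lemma golay24_self_orthogonal:
  assumes "c \<in> golay24" "d \<in> golay24"
  shows "word_dot c d = 0"
proof (rule orthogonal_golay24I[OF _ assms(1)])
  fix i :: nat assume "i < 12"
  then have "word_dot d (golay_row i) = 0"
    using word_dot_golay_rows by (intro orthogonal_golay24I[OF _ assms(2)]) auto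
  then show "word_dot (golay_row i) d = 0" by (simp add: word_dot_commute)
qed

text \<open>
  Adding a codeword clears the first twelve positions, since the rows are triangular there; the
  parity checks then determine position 23 and the positions 12, 13, \<open>\<dots>\<close>, 22 one after the other.
\<close>

lemma golay24_dual:
  assumes c: "c \<in> words 24" and orth: "\<And>i. i < 12 \<Longrightarrow> word_dot (golay_row i) c = 0"
  shows "c \<in> golay24"
proof -
  have "\<exists>d\<in>golay24. \<forall>j<m. (c + d) j = 0" if "m \<le> 12" for m
    using that
  proof (induction m)
    case 0
    then show ?case using golay24_zero by auto
  next
    case (Suc m)
    then obtain d where d: "d \<in> golay24" "\<forall>j<m. (c + d) j = 0" by auto
    show ?case
    proof (cases "(c + d) m = 0")
      case True
      with d show ?thesis by (auto simp: less_Suc_eq)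
    next
      case False
      have "golay_row m j = 0" if "j < m" for j
        using that Suc.prems by (simp add: golay_row_def)
      moreover have "golay_row m m = 1" by (simp add: golay_row_def)
      ultimately have "\<forall>j<Suc m. (c + (d + golay_row m)) j = 0"
        using d(2) False by (auto simp: less_Suc_eq add.assoc[symmetric])
      moreover have "d + golay_row m \<in> golay24"
        using d Suc.prems by (intro golay24_add golay_row_in_golay24) auto
      ultimately show ?thesis by blast
    qed
  qed
  from this[of 12] obtain d where d: "d \<in> golay24" and low: "\<forall>j<12. (c + d) j = 0" by auto
  define e where "e = c + d"
  have e_low: "e 0 = 0" "e 1 = 0" "e 2 = 0" "e 3 = 0" "e 4 = 0" "e 5 = 0" "e 6 = 0" "e 7 = 0"
    "e 8 = 0" "e 9 = 0" "e 10 = 0" "e 11 = 0"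
    using low unfolding e_def by auto
  have checks: "golay_check e i = 0" if "i < 12" for i
  proof -
    have "word_dot (golay_row i) e = 0"
      unfolding e_def word_dot_add_right
      using that golay24_self_orthogonal[OF golay_row_in_golay24 d] orth by simp
    then show ?thesis using that by (simp only: word_dot_golay_row)
  qed
  note checks = checks[unfolded golay_check_def]
  have e23: "e 23 = 0"
    using checks[of 0] e_low
    by (simp del: add_2_eq_Suc')
  have e12: "e 12 = 0"
    using checks[of 1] e_low e23
    by (simp del: add_2_eq_Suc')
  have e13: "e 13 = 0"
    using checks[of 2] e_low e23 e12
    by (simp del: add_2_eq_Suc')
  have e14: "e 14 = 0"
    using checks[of 3] e_low e23 e12 e13
    by (simp del: add_2_eq_Suc')
  have e15: "e 15 = 0"
    using checks[of 4] e_low e23 e12 e13 e14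
    by (simp del: add_2_eq_Suc')
  have e16: "e 16 = 0"
    using checks[of 5] e_low e23 e12 e13 e14 e15
    by (simp del: add_2_eq_Suc')
  have e17: "e 17 = 0"
    using checks[of 6] e_low e23 e12 e13 e14 e15 e16
    by (simp del: add_2_eq_Suc')
  have e18: "e 18 = 0"
    using checks[of 7] e_low e23 e12 e13 e14 e15 e16 e17
    by (simp del: add_2_eq_Suc')
  have e19: "e 19 = 0"
    using checks[of 8] e_low e23 e12 e13 e14 e15 e16 e17 e18
    by (simp del: add_2_eq_Suc')
  have e20: "e 20 = 0"
    using checks[of 9] e_low e23 e12 e13 e14 e15 e16 e17 e18 e19
    by (simp del: add_2_eq_Suc')
  have e21: "e 21 = 0"
    using checks[of 10] e_low e23 e12 e13 e14 e15 e16 e17 e18 e19 e20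
    by (simp del: add_2_eq_Suc')
  have e22: "e 22 = 0"
    using checks[of 11] e_low e23 e12 e13 e14 e15 e16 e17 e18 e19 e20 e21
    by (simp del: add_2_eq_Suc')
  have "e j = 0" if "j < 24" for j
  proof -
    from that have "j < 12 \<or> j = 12 \<or> j = 13 \<or> j = 14 \<or> j = 15 \<or> j = 16 \<or> j = 17 \<or>
      j = 18 \<or> j = 19 \<or> j = 20 \<or> j = 21 \<or> j = 22 \<or> j = 23"
      by presburger
    then show ?thesis
      using low e12 e13 e14 e15 e16 e17 e18 e19 e20 e21 e22 e23 unfolding e_def by blast
  qed
  moreover have "e j = 0" if "\<not> j < 24" for j
    using that c golay24_subset_words d by (auto simp: e_def words_def)
  ultimately have "e j = 0" for j by blast
  then have "c = d" by (simp add: e_def fun_eq_iff bit_add_eq_0_iff)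
  with d show ?thesis by simp
qed

section \<open>Weights in the extended code\<close>

lemma finite_support_words: "c \<in> words n \<Longrightarrow> finite {i. c i \<noteq> 0}"
  by (rule finite_subset[of _ "{..<n}"]) (auto simp: words_def intro: ccontr)

lemma sum_bit_eq_card:
  fixes c :: "'a \<Rightarrow> bit"
  assumes "finite A"
  shows "(\<Sum>i\<in>A. c i) = of_bool (odd (card {i \<in> A. c i \<noteq> 0}))"
  using assms
proof (induction A rule: finite_induct)
  case (insert x F)
  have "{i \<in> insert x F. c i \<noteq> 0} =
      (if c x \<noteq> 0 then insert x {i \<in> F. c i \<noteq> 0} else {i \<in> F. c i \<noteq> 0})"
    by auto
  with insert show ?case by (cases "c x") (simp_all only: sum.insert, auto)
qed simp

text \<open>The support of a sum is the symmetric difference of the supports, and that of the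
  product their intersection. The additive form avoids subtraction of natural numbers.\<close>

lemma weight_add:
  assumes "c \<in> words n" "d \<in> words n"
  shows "weight (c + d) + 2 * card {i. c i * d i \<noteq> 0} = weight c + weight d"
proof -
  let ?C = "{i. c i \<noteq> 0}" and ?D = "{i. d i \<noteq> 0}"
  have fin: "finite ?C" "finite ?D" using assms by (simp_all only: finite_support_words)
  have "{i. (c + d) i \<noteq> 0} = (?C - ?D) \<union> (?D - ?C)"
    using bit_add_eq_0_iff by auto
  then have "weight (c + d) = card (?C - ?D) + card (?D - ?C)"
    unfolding weight_def using fin by (simp only:) (intro card_Un_disjoint; auto)
  moreover have "card ?C = card (?C \<inter> ?D) + card (?C - ?D)"
    "card ?D = card (?D \<inter> ?C) + card (?D - ?C)"
    using fin by (simp_all only: card_Int_Diff[symmetric])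
  moreover have "{i. c i * d i \<noteq> 0} = ?C \<inter> ?D" "?D \<inter> ?C = ?C \<inter> ?D" by auto
  ultimately show ?thesis unfolding weight_def by simp
qed

lemma weight_golay_row:
  assumes "i < 12"
  shows "weight (golay_row i) = 8"
proof -
  have "{j. golay_row i j \<noteq> 0} = insert 23 ((+) i ` {0, 2, 4, 5, 6, 10, 11})"
    by (auto simp: golay_row_def)
  then show ?thesis
    using assms by (simp add: weight_def card_insert_if)
qed

text \<open>Adding a row changes the weight by 8 minus twice the size of the common support, and
  that size is even by self-orthogonality.\<close>

lemma golay24_doubly_even:
  assumes "c \<in> golay24"
  shows "4 dvd weight c"
  using assms
proof (induction rule: golay24_induct)
  case zero
  then show ?case by (simp add: weight_def)
next
  case (add i c)
  have words: "golay_row i \<in> words 24" "c \<in> words 24"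
    using add golay_row_in_golay24 golay24_subset_words by blast+
  have "word_dot (golay_row i) c = 0"
    using add by (intro golay24_self_orthogonal golay_row_in_golay24)
  then have "even (card {j \<in> {..<24}. golay_row i j * c j \<noteq> 0})"
    unfolding word_dot_def by (subst (asm) sum_bit_eq_card) (auto split: if_splits)
  moreover have "j < 24" if "golay_row i j * c j \<noteq> 0" for j
    using words(2) that by (cases "j < 24") (simp_all add: words_def)
  then have "{j \<in> {..<24}. golay_row i j * c j \<noteq> 0} = {j. golay_row i j * c j \<noteq> 0}"
    unfolding lessThan_iff by blast
  ultimately have "4 dvd 2 * card {j. golay_row i j * c j \<noteq> 0}" by auto
  moreover have "4 dvd weight (golay_row i + c) + 2 * card {j. golay_row i j * c j \<noteq> 0}"
    unfolding weight_add[OF words] weight_golay_row[OF add(1)]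
    using add(3) by presburger
  ultimately show "4 dvd weight (golay_row i + c)" by (simp add: dvd_add_left_iff)
qed

text \<open>The parity bit can only raise the weight, so it is at least 7; divisibility by 4 makes
  it at least 8.\<close>

lemma golay24_min_weight:
  assumes "c \<in> golay24" "c \<noteq> 0"
  shows "8 \<le> weight c"
proof -
  from assms obtain d where d: "d \<in> golay23" "c = d(23 := (\<Sum>i<23. d i))"
    unfolding golay24_def by blast
  have "d \<noteq> 0"
  proof
    assume "d = 0"
    then have "c = 0" by (simp add: d(2) fun_eq_iff)
    with assms(2) show False by contradiction
  qed
  then have "7 \<le> weight d" using golay23_min_weight d by blast
  also have "d \<in> words 23" using d golay23_subset_words by blast
  then have "{i. d i \<noteq> 0} \<subseteq> {i. c i \<noteq> 0}" by (auto simp: d words_def)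
  then have "weight d \<le> weight c"
    unfolding weight_def using assms golay24_subset_words
    by (intro card_mono finite_support_words[of c 24]) auto
  finally show ?thesis using golay24_doubly_even[OF assms(1)] by presburger
qed

text \<open>Every row has even weight, so the all-ones word is orthogonal to the code. It allows
  codewords to be complemented.\<close>

lemma golay24_all_ones: "(\<lambda>i. of_bool (i < 24)) \<in> golay24"
proof (rule golay24_dual)
  show "word_dot (golay_row i) (\<lambda>i. of_bool (i < 24)) = 0" if "i < 12" for i
    using that by (simp add: word_dot_golay_row golay_check_def)
qed (simp add: words_def)

lemma word_add_eq_0_iff: "c + d = 0 \<longleftrightarrow> c = d" for c d :: "nat \<Rightarrow> bit"
  by (simp add: fun_eq_iff bit_add_eq_0_iff)

text \<open>Adding the indicator of \<open>S\<close> complements the support of \<open>g\<close>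
  within \<open>S\<close>.\<close>

lemma weight_indicator_add:
  assumes "finite S" "\<And>i. i \<notin> S \<Longrightarrow> g i = 0"
  shows "weight ((\<lambda>i. of_bool (i \<in> S)) + g) + weight g = card S"
proof -
  have sub: "{i. g i \<noteq> 0} \<subseteq> S" using assms(2) by blast
  have "{i. ((\<lambda>i. of_bool (i \<in> S)) + g) i \<noteq> 0} = S - {i. g i \<noteq> 0}"
  proof (rule set_eqI)
    show "i \<in> {i. ((\<lambda>i. of_bool (i \<in> S)) + g) i \<noteq> 0} \<longleftrightarrow> i \<in> S - {i. g i \<noteq> 0}" for i
      using assms(2)[of i] by (cases "i \<in> S"; cases "g i") simp_all
  qed
  then show ?thesis
    unfolding weight_def using sub assms(1) card_mono[OF assms(1) sub]
    by (simp add: card_Diff_subset finite_subset del: bit_not_zero_iff)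
qed

lemma weight_0: "weight 0 = 0"
  by (simp add: weight_def)

section \<open>Involutive automorphisms\<close>

lemma four_dvd_twiceD: "4 dvd 2 * n \<Longrightarrow> even n" for n :: nat
  by presburger

text \<open>The sum vanishes at fixed points and takes equal values at both points of a
  2-cycle.\<close>

lemma weight_add_comp_involution:
  assumes inv: "\<tau> \<circ> \<tau> = id" and fin: "finite {i. \<tau> i \<noteq> i}"
  shows "weight (c + (c \<circ> \<tau>)) = 2 * card {i \<in> {i. i < \<tau> i}. c i + c (\<tau> i) \<noteq> 0}"
proof -
  let ?S = "{i. \<tau> i \<noteq> i}" and ?H = "{i. i < \<tau> i}"
  have \<tau>\<tau>: "\<tau> (\<tau> i) = i" for i
    using inv by (simp add: fun_eq_iff)
  have finH: "finite ?H" by (rule involution_halves(3)[OF inv fin])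
  have "{i. (c + (c \<circ> \<tau>)) i \<noteq> 0} = {i \<in> ?S. c i + c (\<tau> i) \<noteq> 0}"
    by (auto simp: bit_add_eq_0_iff)
  then have "weight (c + (c \<circ> \<tau>)) = (\<Sum>i\<in>?S. of_bool (c i + c (\<tau> i) \<noteq> 0))"
    unfolding weight_def using fin by (simp add: Int_def)
  also have "\<dots> = (\<Sum>i\<in>?H. 2 * of_bool (c i + c (\<tau> i) \<noteq> 0))"
    unfolding sum_involution[OF inv fin] by (simp add: \<tau>\<tau> add.commute mult_2)
  also have "\<dots> = 2 * card {i \<in> ?H. c i + c (\<tau> i) \<noteq> 0}"
    using finH by (simp add: Int_def flip: sum_distrib_left)
  finally show ?thesis .
qed

lemma golay24_moved_mem:
  assumes perm: "\<tau> permutes {..<24}" and inv: "\<tau> \<circ> \<tau> = id"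
    and aut: "\<And>c. c \<in> golay24 \<Longrightarrow> c \<circ> \<tau> \<in> golay24"
  shows "(\<lambda>i. of_bool (\<tau> i \<noteq> i)) \<in> golay24"
proof -
  let ?S = "{i. \<tau> i \<noteq> i}" and ?H = "{i. i < \<tau> i}"
  let ?f = "\<lambda>i. of_bool (\<tau> i \<noteq> i) :: bit"
  have S: "?S \<subseteq> {..<24}"
    using perm by (auto simp: permutes_def)
  then have fin: "finite ?S" by (rule finite_subset) simp
  have finH: "finite ?H" by (rule involution_halves(3)[OF inv fin])
  show ?thesis
  proof (rule golay24_dual)
    show "?f \<in> words 24" using S by (auto simp: words_def)
    fix k :: nat assume "k < 12"
    let ?c = "golay_row k"
    have c: "?c \<in> golay24" using \<open>k < 12\<close> by (rule golay_row_in_golay24)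
    have "4 dvd weight (?c + (?c \<circ> \<tau>))"
      by (rule golay24_doubly_even[OF golay24_add[OF c aut[OF c]]])
    then have "even (card {i \<in> ?H. ?c i + ?c (\<tau> i) \<noteq> 0})"
      unfolding weight_add_comp_involution[OF inv fin] by (rule four_dvd_twiceD)
    \<comment> \<open>Over bits this sum is the parity of the number of 2-cycles on which the row is
      not constant; regrouped over the moved points it is the inner product with
      \<open>?f\<close>.\<close>
    then have "(\<Sum>i\<in>?H. ?c i + ?c (\<tau> i)) = 0"
      unfolding sum_bit_eq_card[OF finH] by simp
    moreover have "word_dot ?c ?f = (\<Sum>i\<in>?S. ?c i)"
      unfolding word_dot_def using S by (intro sum.mono_neutral_cong_right) auto
    ultimately show "word_dot ?c ?f = 0" by (simp only: sum_involution[OF inv fin])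
  qed
qed

text \<open>By the dichotomy, \<open>c i + c (\<tau> i)\<close> has the same value on all 2-cycles,
  so over two of them it cancels. Their union would then be a codeword of weight 4 by
  self-duality.\<close>

lemma golay24_no_constant_on_cycles:
  assumes perm: "\<tau> permutes {..<24}" and inv: "\<tau> \<circ> \<tau> = id"
    and dichotomy: "\<And>c. c \<in> golay24 \<Longrightarrow>
      c + (c \<circ> \<tau>) = 0 \<or> c + (c \<circ> \<tau>) = (\<lambda>i. of_bool (\<tau> i \<noteq> i))"
  shows "card {i. i < \<tau> i} < 2"
proof (rule ccontr)
  let ?S = "{i. \<tau> i \<noteq> i}" and ?H = "{i. i < \<tau> i}"
  let ?f = "\<lambda>i. of_bool (\<tau> i \<noteq> i) :: bit"
  have \<tau>\<tau>: "\<tau> (\<tau> i) = i" for i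
    using inv by (simp add: fun_eq_iff)
  have S: "?S \<subseteq> {..<24}"
    using perm by (auto simp: permutes_def)
  then have fin: "finite ?S" by (rule finite_subset) simp
  assume "\<not> card ?H < 2"
  then have "2 \<le> card ?H" by simp
  then obtain P where P: "P \<subseteq> ?H" "card P = 2"
    by (rule obtain_subset_with_card_n)
  from P(2) obtain a b where "P = {a, b}" "a \<noteq> b"
    unfolding card_2_iff by blast
  with P(1) have ab: "a < \<tau> a" "b < \<tau> b" "a \<noteq> b" by simp_all
  have distinct: "a \<noteq> \<tau> b" "b \<noteq> \<tau> a" "a \<noteq> \<tau> a" "b \<noteq> \<tau> b"
    using ab \<tau>\<tau>[of a] \<tau>\<tau>[of b] by auto
  have "\<tau> a \<noteq> \<tau> b"
    using ab(3) by (simp add: inj_eq[OF involution_halves(4)[OF inv fin]])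
  let ?T = "{a, \<tau> a, b, \<tau> b}"
  let ?w = "\<lambda>i. of_bool (i \<in> ?T) :: bit"
  have "a \<in> ?S" "\<tau> a \<in> ?S" "b \<in> ?S" "\<tau> b \<in> ?S"
    using ab by (simp_all add: \<tau>\<tau>)
  then have T: "?T \<subseteq> {..<24}" using S by blast
  have "?w \<in> golay24"
  proof (rule golay24_dual)
    show "?w \<in> words 24" using T by (auto simp: words_def)
    fix k :: nat assume "k < 12"
    let ?c = "golay_row k"
    have "word_dot ?c ?w = (\<Sum>i\<in>?T. ?c i)"
      unfolding word_dot_def using T by (intro sum.mono_neutral_cong_right) auto
    also have "\<dots> = (?c a + ?c (\<tau> a)) + (?c b + ?c (\<tau> b))"
      using ab(3) distinct distinct[symmetric] \<open>\<tau> a \<noteq> \<tau> b\<close> by (simp add: add.assoc)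
    also have "\<dots> = (?c + (?c \<circ> \<tau>)) a + (?c + (?c \<circ> \<tau>)) b" by simp
    also have "\<dots> = 0"
      using dichotomy[OF golay_row_in_golay24[OF \<open>k < 12\<close>]]
    proof
      assume eq: "?c + (?c \<circ> \<tau>) = 0"
      show ?thesis unfolding eq by simp
    next
      assume eq: "?c + (?c \<circ> \<tau>) = ?f"
      \<comment> \<open>Both cycles consist of moved points, so the sum is
        \<open>1 + 1 = 0\<close>.\<close>
      show ?thesis unfolding eq using ab by simp
    qed
    finally show "word_dot ?c ?w = 0" .
  qed
  moreover have "?w \<noteq> 0"
  proof
    assume "?w = 0"
    then have "?w a = 0 a" by (rule fun_cong)
    then show False by simp
  qed
  ultimately have "8 \<le> weight ?w" by (rule golay24_min_weight)
  moreover have "{i. ?w i \<noteq> 0} = ?T" by auto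
  then have "weight ?w = card ?T" unfolding weight_def by (rule arg_cong)
  moreover have "card ?T \<le> 4" using card_length[of "[a, \<tau> a, b, \<tau> b]"] by simp
  ultimately show False by linarith
qed

text \<open>Otherwise \<open>c + (c \<circ> \<tau>)\<close> and its complement within the moved set
  are both nonzero codewords; their weights are at least 8 each and add up to the number of moved
  points.\<close>

lemma golay24_moved_dichotomy:
  assumes inv: "\<tau> \<circ> \<tau> = id" and fin: "finite {i. \<tau> i \<noteq> i}"
    and aut: "\<And>c. c \<in> golay24 \<Longrightarrow> c \<circ> \<tau> \<in> golay24"
    and f: "(\<lambda>i. of_bool (\<tau> i \<noteq> i)) \<in> golay24" and small: "card {i. \<tau> i \<noteq> i} < 16"
    and c: "c \<in> golay24"
  shows "c + (c \<circ> \<tau>) = 0 \<or> c + (c \<circ> \<tau>) = (\<lambda>i. of_bool (\<tau> i \<noteq> i))"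
proof (rule ccontr)
  let ?S = "{i. \<tau> i \<noteq> i}" and ?f = "\<lambda>i. of_bool (\<tau> i \<noteq> i) :: bit"
  define g where "g = c + (c \<circ> \<tau>)"
  assume "\<not> (c + (c \<circ> \<tau>) = 0 \<or> c + (c \<circ> \<tau>) = ?f)"
  then have "g \<noteq> 0" "g \<noteq> ?f" by (simp_all only: g_def de_Morgan_disj not_False_eq_True)
  then have nz: "g \<noteq> 0" "?f + g \<noteq> 0"
    by (simp_all only: word_add_eq_0_iff add.commute[of ?f] not_False_eq_True)
  have g: "g \<in> golay24" unfolding g_def by (rule golay24_add[OF c aut[OF c]])
  have "g i = 0" if "i \<notin> ?S" for i using that by (simp add: g_def)
  then have "weight (?f + g) + weight g = card ?S"
    using weight_indicator_add[OF fin, of g] by simp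
  moreover have "8 \<le> weight g" using g nz(1) by (rule golay24_min_weight)
  moreover have "8 \<le> weight (?f + g)"
    using golay24_add[OF f g] nz(2) by (rule golay24_min_weight)
  ultimately show False using small by linarith
qed

lemma golay24_involution_moved:
  assumes perm: "\<tau> permutes {..<24}" and inv: "\<tau> \<circ> \<tau> = id"
    and aut: "\<And>c. c \<in> golay24 \<Longrightarrow> c \<circ> \<tau> \<in> golay24"
    and moved: "{i. \<tau> i \<noteq> i} \<noteq> {}"
  shows "card {i. \<tau> i \<noteq> i} \<in> {16, 24}"
proof -
  let ?S = "{i. \<tau> i \<noteq> i}" and ?H = "{i. i < \<tau> i}"
  let ?f = "\<lambda>i. of_bool (\<tau> i \<noteq> i) :: bit"
  have S: "?S \<subseteq> {..<24}"
    using perm by (auto simp: permutes_def)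
  then have fin: "finite ?S" by (rule finite_subset) simp
  have f: "?f \<in> golay24" by (rule golay24_moved_mem[OF perm inv aut])
  have weight_f: "weight ?f = card ?S" by (simp add: weight_def)
  obtain a where "\<tau> a \<noteq> a" using moved by blast
  have "?f \<noteq> 0"
  proof
    assume "?f = 0"
    then have "?f a = 0 a" by (rule fun_cong)
    with \<open>\<tau> a \<noteq> a\<close> show False by simp
  qed
  then have ge8: "8 \<le> card ?S" using golay24_min_weight[OF f] weight_f by simp
  have four: "4 dvd card ?S" using golay24_doubly_even[OF f] weight_f by simp
  have le24: "card ?S \<le> 24" using card_mono[OF _ S] by simp
  have ne20: "card ?S \<noteq> 20"
  proof
    assume card: "card ?S = 20"
    \<comment> \<open>The complement of the moved set would be a codeword of weight 4.\<close>
    let ?g = "?f + (\<lambda>i. of_bool (i < 24))"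
    have "{i. ?g i \<noteq> 0} = {..<24} - ?S" using S by auto
    then have weight: "weight ?g = 4"
      unfolding weight_def using S fin card by (simp add: card_Diff_subset)
    have "?g \<noteq> 0"
    proof
      assume "?g = 0"
      then have "weight ?g = weight 0" by (rule arg_cong)
      then show False using weight by (simp only: weight_0)
    qed
    then have "8 \<le> weight ?g"
      by (rule golay24_min_weight[OF golay24_add[OF f golay24_all_ones]])
    then show False using weight by linarith
  qed
  have ge16: "16 \<le> card ?S"
  proof (rule ccontr)
    assume "\<not> 16 \<le> card ?S"
    then have small: "card ?S < 16" by simp
    \<comment> \<open>At most one 2-cycle means at most two moved points, against
      \<open>ge8\<close>.\<close>
    have "card ?H < 2"
      by (rule golay24_no_constant_on_cycles[OF perm inv golay24_moved_dichotomy[OF inv fin aut f small]])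
    then show False
      using sum_involution[OF inv fin, of "\<lambda>_. 1 :: nat"] ge8 by simp
  qed
  have "n = 16 \<or> n = 24" if "4 dvd n" "n \<le> 24" "n \<noteq> 20" "16 \<le> n" for n :: nat
    using that by presburger
  from this[OF four le24 ne20 ge16] show ?thesis by simp
qed

text \<open>Composition with \<open>\<tau>\<close> is linear, so the images of the rows decide; by
  self-duality their membership is a matter of parity checks, a finite computation.\<close>

lemma golay24_automorphismI:
  assumes perm: "\<tau> permutes {..<24}"
    and rows: "\<forall>i\<in>set [0..<12]. \<forall>k\<in>set [0..<12]. golay_check (golay_row k \<circ> \<tau>) i = 0"
    and c: "c \<in> golay24"
  shows "c \<circ> \<tau> \<in> golay24"
  using c
proof (induction rule: golay24_induct)
  case zero
  have "0 \<circ> \<tau> = (0 :: nat \<Rightarrow> bit)" by (simp add: fun_eq_iff)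
  then show "0 \<circ> \<tau> \<in> golay24" using golay24_zero by simp
next
  case (add k c)
  have "golay_row k \<in> words 24"
    using golay_row_in_golay24[OF add(1)] golay24_subset_words by blast
  moreover have "word_dot (golay_row i) (golay_row k \<circ> \<tau>) = 0" if "i < 12" for i
    using rows that add(1) by (simp add: word_dot_golay_row)
  ultimately have "golay_row k \<circ> \<tau> \<in> golay24"
    by (intro golay24_dual words_comp perm)
  then have "(golay_row k \<circ> \<tau>) + (c \<circ> \<tau>) \<in> golay24"
    using add(3) by (rule golay24_add)
  moreover have "(golay_row k + c) \<circ> \<tau> = (golay_row k \<circ> \<tau>) + (c \<circ> \<tau>)"
    by (simp add: fun_eq_iff)
  ultimately show "(golay_row k + c) \<circ> \<tau> \<in> golay24"
    by (simp only:)
qed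

section \<open>Passing between lengths 23 and 24\<close>

definition parity_extend :: "(nat \<Rightarrow> bit) \<Rightarrow> nat \<Rightarrow> bit" where
  "parity_extend c = c(23 := (\<Sum>i<23. c i))"

lemma golay24_eq_parity_extend: "golay24 = parity_extend ` golay23"
  by (simp add: golay24_def parity_extend_def)

text \<open>The extension is injective on words of length 23, since these vanish at position 23 and
  the other entries are kept.\<close>

lemma parity_extend_mem_golay24_iff:
  assumes "c \<in> words 23"
  shows "parity_extend c \<in> golay24 \<longleftrightarrow> c \<in> golay23"
proof
  assume "parity_extend c \<in> golay24"
  then obtain d where d: "d \<in> golay23" "parity_extend c = parity_extend d"
    unfolding golay24_eq_parity_extend by blast
  have "c i = d i" for i
  proof (cases "i = 23")
    case True
    then show ?thesis
      using assms d(1) golay23_subset_words by (auto simp: words_def)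
  next
    case False
    then show ?thesis
      using fun_cong[OF d(2), of i] by (simp add: parity_extend_def)
  qed
  then have "c = d" by (rule ext)
  with d(1) show "c \<in> golay23" by simp
qed (simp add: golay24_eq_parity_extend)

text \<open>\<open>\<tau>\<close> fixes position 23 and only rearranges the terms of the parity
  sum.\<close>

lemma parity_extend_comp:
  assumes "\<tau> permutes {..<23}"
  shows "parity_extend c \<circ> \<tau> = parity_extend (c \<circ> \<tau>)"
proof (rule ext)
  fix i
  have "\<tau> i = 23 \<longleftrightarrow> i = 23"
    using inj_eq[OF permutes_inj[OF assms], of i 23] permutes_not_in[OF assms, of 23] by simp
  moreover have "(\<Sum>i<23. (c \<circ> \<tau>) i) = (\<Sum>i<23. c i)"
    using sum.permute[OF assms, of c] by simp
  ultimately show "(parity_extend c \<circ> \<tau>) i = parity_extend (c \<circ> \<tau>) i"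
    by (simp add: parity_extend_def)
qed

text \<open>Reduces length 23 to automorphisms of the extended code that fix position 23.\<close>

lemma golay23_automorphism_iff:
  assumes "\<tau> permutes {..<23}"
  shows "(\<forall>c\<in>golay23. c \<circ> \<tau> \<in> golay23) \<longleftrightarrow> (\<forall>c\<in>golay24. c \<circ> \<tau> \<in> golay24)"
proof -
  have "c \<circ> \<tau> \<in> golay23 \<longleftrightarrow> parity_extend c \<circ> \<tau> \<in> golay24" if "c \<in> golay23" for c
    using that golay23_subset_words words_comp[OF _ assms]
    by (subst parity_extend_mem_golay24_iff[symmetric]) (auto simp: parity_extend_comp[OF assms])
  then show ?thesis by (simp add: golay24_eq_parity_extend)
qed

section \<open>The criterion for the two Golay codes, and explicit involutions\<close>

lemma z2z2u_linear_golay24_iff: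
  "z2z2u_linear 24 golay24 \<alpha> \<beta> \<longleftrightarrow> 24 = \<alpha> + 2 * \<beta> \<and>
     (\<exists>\<tau>. \<tau> permutes {..<24} \<and> \<tau> \<circ> \<tau> = id \<and> card {i. \<tau> i \<noteq> i} = 2 * \<beta> \<and>
       (\<forall>c\<in>golay24. c \<circ> \<tau> \<in> golay24))"
  by (simp add: z2z2u_linear_iff_involution golay24_subset_words golay24_zero golay24_add)

lemma z2z2u_linear_golay23_iff:
  "z2z2u_linear 23 golay23 \<alpha> \<beta> \<longleftrightarrow> 23 = \<alpha> + 2 * \<beta> \<and>
     (\<exists>\<tau>. \<tau> permutes {..<23} \<and> \<tau> \<circ> \<tau> = id \<and> card {i. \<tau> i \<noteq> i} = 2 * \<beta> \<and>
       (\<forall>c\<in>golay24. c \<circ> \<tau> \<in> golay24))"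
  by (simp add: z2z2u_linear_iff_involution golay23_subset_words golay23_zero golay23_add
      golay23_automorphism_iff cong: conj_cong)

text \<open>A permutation as a table of images, so that involutivity, moved points and parity checks
  can be evaluated.\<close>

definition list_map :: "nat list \<Rightarrow> nat \<Rightarrow> nat" where
  "list_map xs i = (if i < length xs then xs ! i else i)"

lemma list_map_involution:
  assumes "\<forall>i\<in>set [0..<length xs]. xs ! i < length xs \<and> xs ! (xs ! i) = i"
  shows "list_map xs \<circ> list_map xs = id"
  using assms by (auto simp: list_map_def fun_eq_iff)

lemma list_map_involution_permutes:
  assumes "list_map xs \<circ> list_map xs = id" "length xs \<le> n"
  shows "list_map xs permutes {..<n}"
  using assms by (intro involution_permutes) (auto simp: list_map_def)

lemma list_map_moved: "{i. list_map xs i \<noteq> i} = set (filter (\<lambda>i. xs ! i \<noteq> i) [0..<length xs])"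
  by (auto simp: list_map_def)

text \<open>
  In cycle notation \<open>\<tau>\<close> is \<open>(0 1)(2 7)(3 4)(8 17)(9 13)(10 12)(14 15)(18 22)\<close>, found by computer.
\<close>

lemma golay_involution_8_8:
  defines "\<tau> \<equiv> list_map
    [1, 0, 7, 4, 3, 5, 6, 2, 17, 13, 12, 11, 10, 9, 15, 14, 16, 8, 22, 19, 20, 21, 18]"
  shows "\<tau> permutes {..<23}" "\<tau> \<circ> \<tau> = id" "card {i. \<tau> i \<noteq> i} = 2 * 8"
    "c \<in> golay24 \<Longrightarrow> c \<circ> \<tau> \<in> golay24"
proof -
  show inv: "\<tau> \<circ> \<tau> = id"
    unfolding \<tau>_def
    by (rule list_map_involution) code_simp
  show "\<tau> permutes {..<23}"
    using inv unfolding \<tau>_def by (rule list_map_involution_permutes) simp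
  show "card {i. \<tau> i \<noteq> i} = 2 * 8"
    unfolding \<tau>_def list_map_moved by (simp add: upt_rec)
  assume "c \<in> golay24"
  then show "c \<circ> \<tau> \<in> golay24"
  proof (rule golay24_automorphismI[rotated 2])
    show "\<tau> permutes {..<24}"
      using inv unfolding \<tau>_def by (rule list_map_involution_permutes) simp
    show "\<forall>i\<in>set [0..<12]. \<forall>k\<in>set [0..<12]. golay_check (golay_row k \<circ> \<tau>) i = 0"
      unfolding \<tau>_def by code_simp
  qed
qed

text \<open>
  With position 23 as the point at infinity of the projective line over the integers modulo 23,
  this is \<open>x \<mapsto> -1 / x\<close>; it has no fixed point because \<open>-1\<close> is not a square modulo 23.
\<close>

lemma golay_involution_0_12:
  defines "\<tau> \<equiv> list_map
    [23, 22, 11, 15, 17, 9, 19, 13, 20, 5, 16, 2, 21, 7, 18, 3, 10, 4, 14, 6, 8, 12, 1, 0]"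
  shows "\<tau> permutes {..<24}" "\<tau> \<circ> \<tau> = id" "card {i. \<tau> i \<noteq> i} = 2 * 12"
    "c \<in> golay24 \<Longrightarrow> c \<circ> \<tau> \<in> golay24"
proof -
  show inv: "\<tau> \<circ> \<tau> = id"
    unfolding \<tau>_def
    by (rule list_map_involution) code_simp
  show perm: "\<tau> permutes {..<24}"
    using inv unfolding \<tau>_def by (rule list_map_involution_permutes) simp
  show "card {i. \<tau> i \<noteq> i} = 2 * 12"
    unfolding \<tau>_def list_map_moved by (simp add: upt_rec)
  have "\<forall>i\<in>set [0..<12]. \<forall>k\<in>set [0..<12]. golay_check (golay_row k \<circ> \<tau>) i = 0"
    unfolding \<tau>_def by code_simp
  then show "c \<in> golay24 \<Longrightarrow> c \<circ> \<tau> \<in> golay24"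
    by (rule golay24_automorphismI[OF perm])
qed

theorem theorem2:
  shows "(\<exists>\<alpha> \<beta>. z2z2u_linear 23 golay23 \<alpha> \<beta>) \<and>
    (\<exists>\<alpha> \<beta>. z2z2u_linear 24 golay24 \<alpha> \<beta>) \<and>
    {(\<alpha>, \<beta>). \<beta> > 0 \<and> z2z2u_linear 24 golay24 \<alpha> \<beta>} = {(0, 12), (8, 8)} \<and>
    {(\<alpha>, \<beta>). \<beta> > 0 \<and> z2z2u_linear 23 golay23 \<alpha> \<beta>} = {(7, 8)}"
proof -
  have card: "2 * \<beta> \<in> {16, 24}"
    if "\<tau> permutes {..<24}" "\<tau> \<circ> \<tau> = id" "card {i. \<tau> i \<noteq> i} = 2 * \<beta>" "0 < \<beta>"
      "\<forall>c\<in>golay24. c \<circ> \<tau> \<in> golay24" for \<tau> \<beta>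
  proof -
    have "{i. \<tau> i \<noteq> i} \<noteq> {}" using that(3,4) by (intro notI) simp
    then show ?thesis using golay24_involution_moved[of \<tau>] that by simp
  qed
  have G24: "(\<alpha>, \<beta>) \<in> {(0, 12), (8, 8)}" if pos: "0 < \<beta>" and lin: "z2z2u_linear 24 golay24 \<alpha> \<beta>" for \<alpha> \<beta>
  proof -
    obtain \<tau> where \<tau>: "24 = \<alpha> + 2 * \<beta>" "\<tau> permutes {..<24}" "\<tau> \<circ> \<tau> = id"
      "card {i. \<tau> i \<noteq> i} = 2 * \<beta>" "\<forall>c\<in>golay24. c \<circ> \<tau> \<in> golay24"
      using lin unfolding z2z2u_linear_golay24_iff by blast
    from card[OF \<tau>(2-4) pos \<tau>(5)] \<tau>(1) show ?thesis by auto
  qed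
  have G23: "(\<alpha>, \<beta>) = (7, 8)" if pos: "0 < \<beta>" and lin: "z2z2u_linear 23 golay23 \<alpha> \<beta>" for \<alpha> \<beta>
  proof -
    obtain \<tau> where \<tau>: "23 = \<alpha> + 2 * \<beta>" "\<tau> permutes {..<23}" "\<tau> \<circ> \<tau> = id"
      "card {i. \<tau> i \<noteq> i} = 2 * \<beta>" "\<forall>c\<in>golay24. c \<circ> \<tau> \<in> golay24"
      using lin unfolding z2z2u_linear_golay23_iff by blast
    \<comment> \<open>As a function, \<open>\<tau>\<close> already fixes position 23, so the moved
      points are the same at length 24.\<close>
    have "\<tau> permutes {..<24}" by (rule permutes_subset[OF \<tau>(2)]) auto
    \<comment> \<open>Twelve 2-cycles would need 24 positions, which leaves
      \<open>\<beta> = 8\<close>.\<close>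
    from card[OF this \<tau>(3,4) pos \<tau>(5)] \<tau>(1) show ?thesis by auto
  qed
  have L24: "z2z2u_linear 24 golay24 0 12" "z2z2u_linear 24 golay24 8 8"
  proof -
    have "\<exists>\<tau>. \<tau> permutes {..<24} \<and> \<tau> \<circ> \<tau> = id \<and> card {i. \<tau> i \<noteq> i} = 2 * 12 \<and>
        (\<forall>c\<in>golay24. c \<circ> \<tau> \<in> golay24)"
      by (intro exI conjI ballI) (rule golay_involution_0_12; assumption)+
    then show "z2z2u_linear 24 golay24 0 12" by (simp add: z2z2u_linear_golay24_iff)
    \<comment> \<open>The involution used for length 23 also serves here, with position 23 as the
      eighth fixed point.\<close>
    have sub: "{..<23} \<subseteq> {..<24 :: nat}" by auto
    have "\<exists>\<tau>. \<tau> permutes {..<24} \<and> \<tau> \<circ> \<tau> = id \<and> card {i. \<tau> i \<noteq> i} = 2 * 8 \<and>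
        (\<forall>c\<in>golay24. c \<circ> \<tau> \<in> golay24)"
      by (intro exI conjI ballI)
        (rule permutes_subset[OF golay_involution_8_8(1) sub] golay_involution_8_8(2-4); assumption)+
    then show "z2z2u_linear 24 golay24 8 8" by (simp add: z2z2u_linear_golay24_iff)
  qed
  have L23: "z2z2u_linear 23 golay23 7 8"
  proof -
    have "\<exists>\<tau>. \<tau> permutes {..<23} \<and> \<tau> \<circ> \<tau> = id \<and> card {i. \<tau> i \<noteq> i} = 2 * 8 \<and>
        (\<forall>c\<in>golay24. c \<circ> \<tau> \<in> golay24)"
      by (intro exI conjI ballI) (rule golay_involution_8_8; assumption)+
    then show ?thesis by (simp add: z2z2u_linear_golay23_iff)
  qed
  have S24: "{(\<alpha>, \<beta>). \<beta> > 0 \<and> z2z2u_linear 24 golay24 \<alpha> \<beta>} = {(0, 12), (8, 8)}"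
    using G24 L24 by (intro subset_antisym subsetI) auto
  have S23: "{(\<alpha>, \<beta>). \<beta> > 0 \<and> z2z2u_linear 23 golay23 \<alpha> \<beta>} = {(7, 8)}"
    using G23 L23 by (intro subset_antisym subsetI) auto
  show ?thesis
    by (intro conjI exI) (rule L23 L24(1) S24 S23)+
qed

end
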